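(* Fix an integer $k\ge1$. For $n\ge1$ let $\mathcal{P}_n=\mathcal{P}(2k+1,\ldots,2k+1)$ be the pretzel link with $n$ tangles, each consisting of $2k+1$ crossings. Then $M(V_{\mathcal{P}_n}(t))\to\infty$ as $n\to\infty$.
   Context: $\mathcal{P}(a_1,\ldots,a_n)$ denotes the pretzel link formed by $n$ vertical twist regions (two-strand twist tangles) with $a_1,\ldots,a_n$ half-twists placed side by side and connected in the standard cyclic way; $\mathcal{P}_n$ is a knot if $n$ is odd and a two-component link if $n$ is even. $V_L(t)$ is the Jones polynomial, and $M$ is the Mahler measure $M(f)=\exp\int_0^1\log|f(e^{2\pi i\theta})|\,d\theta$, which is unaffected by monomial factors (including fractional powers of $t$). *)

theory Defs
  imports "HOL-Analysis.Analysis"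
begin

text \<open>
Standard diagram of the pretzel link P(c,...,c) with n vertical twist regions,
each having c crossings.  Crossing (i,j): region i < n, position j < c (top to
bottom).  Every crossing has four endpoints (i,j,p) with
p = 0 (top-left), 1 (top-right), 2 (bottom-left), 3 (bottom-right).
\<close>

definition pretzel_crossings :: "nat \<Rightarrow> nat \<Rightarrow> (nat \<times> nat) set" where
  "pretzel_crossings n c = {0..<n} \<times> {0..<c}"

definition pretzel_endpoints :: "nat \<Rightarrow> nat \<Rightarrow> (nat \<times> nat \<times> nat) set" where
  "pretzel_endpoints n c = {(i,j,p). i < n \<and> j < c \<and> p < 4}"

text \<open>Arcs of the diagram: inside a twist region the bottom endpoints of
crossing j are joined to the top endpoints of crossing j+1; the tops (resp.
bottoms) of consecutive regions are joined cyclically.\<close>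

definition pretzel_arcs :: "nat \<Rightarrow> nat \<Rightarrow> ((nat \<times> nat \<times> nat) \<times> (nat \<times> nat \<times> nat)) set" where
  "pretzel_arcs n c =
     {((i,j,2),(i,Suc j,0)) | i j. i < n \<and> Suc j < c}
   \<union> {((i,j,3),(i,Suc j,1)) | i j. i < n \<and> Suc j < c}
   \<union> {((i,0,1),(Suc i mod n,0,0)) | i. i < n}
   \<union> {((i,c-1,3),(Suc i mod n,c-1,2)) | i. i < n}"

text \<open>Kauffman state: S is the set of crossings receiving the A-smoothing
(joining top-left with top-right and bottom-left with bottom-right); all other
crossings receive the B-smoothing (joining top-left with bottom-left and
top-right with bottom-right).  All crossings of P(c,...,c), c > 0, have the
same type, so this is a consistent choice (the opposite choice gives the
mirror image, which changes V(t) to V(1/t) and does not change M).\<close>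

definition pretzel_smoothing ::
  "nat \<Rightarrow> nat \<Rightarrow> (nat \<times> nat) set \<Rightarrow> ((nat \<times> nat \<times> nat) \<times> (nat \<times> nat \<times> nat)) set" where
  "pretzel_smoothing n c S =
     {((i,j,0),(i,j,1)) | i j. (i,j) \<in> S}
   \<union> {((i,j,2),(i,j,3)) | i j. (i,j) \<in> S}
   \<union> {((i,j,0),(i,j,2)) | i j. (i,j) \<in> pretzel_crossings n c - S}
   \<union> {((i,j,1),(i,j,3)) | i j. (i,j) \<in> pretzel_crossings n c - S}"

text \<open>Number of loops of the state S = number of connected components of
the graph formed by the arcs and the smoothing edges.\<close>

definition pretzel_loops :: "nat \<Rightarrow> nat \<Rightarrow> (nat \<times> nat) set \<Rightarrow> nat" where
  "pretzel_loops n c S =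
     (let R = pretzel_arcs n c \<union> pretzel_smoothing n c S
      in card (pretzel_endpoints n c // ((R \<union> R\<inverse>)\<^sup>*)))"

text \<open>Kauffman bracket (state sum), evaluated at A.\<close>

definition pretzel_bracket :: "nat \<Rightarrow> nat \<Rightarrow> complex \<Rightarrow> complex" where
  "pretzel_bracket n c A =
     (\<Sum>S\<in>Pow (pretzel_crossings n c).
        A powi (int (card S) - int (card (pretzel_crossings n c - S)))
        * (- (A^2) - inverse (A^2)) ^ (pretzel_loops n c S - 1))"

text \<open>Jones polynomial V(t) = (-A^3)^(-w) <D> with A = t^(-1/4), w the writhe
of the (oriented) diagram; evaluated here as a function of A.\<close>

definition pretzel_jones_A :: "int \<Rightarrow> nat \<Rightarrow> nat \<Rightarrow> complex \<Rightarrow> complex" where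
  "pretzel_jones_A w n c A = (- (A^3)) powi (- w) * pretzel_bracket n c A"

text \<open>Mahler measure of a function on the unit circle, given as a function of
theta, t = exp(2 pi i theta).\<close>

definition mahler_measure_circle :: "(real \<Rightarrow> complex) \<Rightarrow> real" where
  "mahler_measure_circle f = exp (integral {0..1} (\<lambda>\<theta>. ln (cmod (f \<theta>))))"

text \<open>M(V(t)): at t = exp(2 pi i theta) we take A = exp(-2 pi i theta / 4);
the modulus |V(t)| does not depend on the branch of t^(1/4).\<close>

definition pretzel_jones_mahler :: "int \<Rightarrow> nat \<Rightarrow> nat \<Rightarrow> real" where
  "pretzel_jones_mahler w n c =
     mahler_measure_circle (\<lambda>\<theta>. pretzel_jones_A w n c (cis (- (pi * \<theta> / 2))))"

end

theory Submission
  imports Defs "HOL-Complex_Analysis.Conformal_Mappings"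
    "HOL-Computational_Algebra.Fundamental_Theorem_Algebra" "HOL-Real_Asymp.Real_Asymp"
begin

text \<open>
  A twist region with at least one A-smoothing is the horizontal smoothing together with some closed
  loops, and otherwise it is the vertical one. Counting loops turns the state sum into the closed form
  \<open>d \<langle>D\<rangle> = X\<^sup>n + (d\<^sup>2 - 1) Y\<^sup>n\<close>, so that on the unit circle \<open>\<bar>V\<bar> = \<bar>P\<^sub>n(s)\<bar> / \<bar>1 + s\<bar>\<^sup>n\<^sup>+\<^sup>1\<close> with
  \<open>s = A\<^sup>4\<close> and a polynomial \<open>P\<^sub>n = s a\<^sup>n + (1 + s + s\<^sup>2) b\<^sup>n\<close>. By Jensen's formula the Mahler measure
  of \<open>V\<close> is that of \<open>P\<^sub>n\<close>.

  The roots of \<open>b\<close> lie in the closed unit disc, and \<open>b\<close> has a root \<open>\<zeta>\<close> of modulus 1 with \<open>a(\<zeta>) \<noteq> 0\<close>. For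
  \<open>\<bar>s\<bar> > 1\<close>, the product of \<open>\<bar>p(u s)\<bar>\<close> over the \<open>N\<close>-th roots of unity \<open>u\<close> is, up to the leading
  coefficient, the product of \<open>\<bar>\<alpha>\<^sup>N - s\<^sup>N\<bar>\<close> over the roots \<open>\<alpha>\<close> of \<open>p\<close>. Hence it is at most
  \<open>(\<bar>s\<bar>\<^sup>N + 1) ^ deg p M(p)\<^sup>N\<close>, and for \<open>p = b\<close> at least \<open>(\<bar>s\<bar>\<^sup>N - 1) ^ deg b\<close>. If \<open>s\<close> is close to
  \<open>\<zeta>\<close>, so that \<open>\<bar>a(s)\<bar> > 2 \<bar>b(s)\<bar>\<close>, and \<open>N\<close> is large, then the product of \<open>max \<bar>a(u s)\<bar> \<bar>b(u s)\<bar>\<close>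
  exceeds \<open>(\<bar>s\<bar>\<^sup>N + 1) ^ deg b\<close>; and for generic \<open>s\<close> its \<open>n\<close>-th power is, up to a constant, a lower
  bound for the product of the \<open>\<bar>P\<^sub>n(u s)\<bar>\<close>. So \<open>M(P\<^sub>n)\<^sup>N\<close> grows geometrically.
\<close>

section \<open>Loops of a Kauffman state\<close>

definition count_below :: "nat set \<Rightarrow> nat \<Rightarrow> nat" where
  "count_below X l = card {x \<in> X. x < l}"

lemma count_below_0 [simp]: "count_below X 0 = 0"
  by (simp add: count_below_def)

lemma count_below_empty [simp]: "count_below {} l = 0"
  by (simp add: count_below_def)

lemma count_below_Suc [simp]:
  "count_below X (Suc l) = (if l \<in> X then Suc (count_below X l) else count_below X l)"
proof -
  have "{x \<in> X. x < Suc l} = (if l \<in> X then insert l {x \<in> X. x < l} else {x \<in> X. x < l})"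
    by (auto simp: less_Suc_eq)
  then show ?thesis
    by (simp add: count_below_def)
qed

lemma count_below_mono: "l \<le> m \<Longrightarrow> count_below X l \<le> count_below X m"
  unfolding count_below_def by (rule card_mono) auto

lemma count_below_eq_card: "X \<subseteq> {..<m} \<Longrightarrow> count_below X m = card X"
  unfolding count_below_def by (rule arg_cong[of _ _ card]) auto

lemma count_below_attained: "k \<le> count_below X m \<Longrightarrow> \<exists>l\<le>m. count_below X l = k"
  using nat0_intermed_int_val[of m "\<lambda>l. int (count_below X l)" "int k"] by simp

lemma eq_if_count_below_eq:
  assumes steps: "\<And>l. l < m \<Longrightarrow> l \<notin> X \<Longrightarrow> f (Suc l) = f l"
    and "l \<le> m" "l' \<le> m" "count_below X l = count_below X l'"
  shows "f l = f l'"
proof -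
  have "f l = f l'" if "l \<le> l'" "l' \<le> m" "count_below X l = count_below X l'" for l l'
    using that
  proof (induction l' rule: dec_induct)
    case (step l')
    have "count_below X l \<le> count_below X l'"
      using step by (intro count_below_mono) auto
    then have "l' \<notin> X" "count_below X l = count_below X l'"
      using step by (auto split: if_splits)
    then show ?case
      using step steps[of l'] by simp
  qed simp
  from this[of l l'] this[of l' l] show ?thesis
    using assms(2-4) by (metis nat_le_linear)
qed

lemma eq_if_steps_eq:
  assumes "\<And>l. l < m \<Longrightarrow> f (Suc l) = f l" "l \<le> m" "l' \<le> m"
  shows "f l = f l'"
  by (rule eq_if_count_below_eq[of m "{}"]) (use assms in auto)

lemma card_image_eq_card_image:
  assumes "\<And>x y. x \<in> A \<Longrightarrow> y \<in> A \<Longrightarrow> f x = f y \<longleftrightarrow> g x = g y"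
  shows "card (f ` A) = card (g ` A)"
proof -
  let ?h = "\<lambda>v. g (inv_into A f v)"
  have h_apply: "?h (f x) = g x" if "x \<in> A" for x
    using assms[of "inv_into A f (f x)" x] that by (simp add: inv_into_into f_inv_into_f)
  have "inj_on ?h (f ` A)"
    using assms by (auto simp: inj_on_def h_apply)
  then have "card (?h ` f ` A) = card (f ` A)"
    by (rule card_image)
  also have "?h ` f ` A = g ` A"
    by (simp add: image_image h_apply)
  finally show ?thesis
    by (rule sym)
qed

type_synonym endpoint = "nat \<times> nat \<times> nat"

locale pretzel_state =
  fixes n c :: nat and S :: "(nat \<times> nat) set"
  assumes n_pos: "n > 0" and c_pos: "c > 0" and S_subset: "S \<subseteq> pretzel_crossings n c"
begin

definition edges :: "(endpoint \<times> endpoint) set" where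
  "edges = pretzel_arcs n c \<union> pretzel_smoothing n c S"

definition loop :: "endpoint \<Rightarrow> endpoint set" where
  "loop x = (edges \<union> edges\<inverse>)\<^sup>* `` {x}"

lemma pretzel_loops_eq_card_loop: "pretzel_loops n c S = card (loop ` pretzel_endpoints n c)"
proof -
  have "pretzel_endpoints n c // (edges \<union> edges\<inverse>)\<^sup>* = loop ` pretzel_endpoints n c"
    by (auto simp: quotient_def loop_def)
  then show ?thesis
    by (simp add: pretzel_loops_def edges_def)
qed

lemma loop_eq_iff: "loop x = loop y \<longleftrightarrow> (x, y) \<in> (edges \<union> edges\<inverse>)\<^sup>*"
proof -
  have "equiv UNIV ((edges \<union> edges\<inverse>)\<^sup>*)"
    by (intro equivI refl_rtrancl trans_rtrancl sym_rtrancl sym_Un_converse) auto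
  then show ?thesis
    by (simp add: loop_def eq_equiv_class_iff)
qed

lemma loop_edge: "(x, y) \<in> edges \<Longrightarrow> loop x = loop y"
  by (auto simp: loop_eq_iff)

lemma loop_invariant:
  assumes "loop x = loop y" and "\<And>x y. (x, y) \<in> edges \<Longrightarrow> f x = f y"
  shows "f x = f y"
  using assms(1) unfolding loop_eq_iff
  by (induction rule: rtrancl_induct) (auto dest: assms(2))

text \<open>Level \<open>l\<close> of a region lies just above its crossing \<open>l\<close>, and level \<open>c\<close> below its last crossing. The
  sides \<open>0\<close> and \<open>1\<close> of a level are its left and its right strand.\<close>

definition level_point :: "nat \<Rightarrow> nat \<Rightarrow> nat \<Rightarrow> endpoint" where
  "level_point i l s = (if l < c then (i, l, s) else (i, c - 1, s + 2))"

abbreviation A_above :: "nat \<Rightarrow> nat \<Rightarrow> nat" where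
  "A_above i \<equiv> count_below (S `` {i})"

definition vertical :: "nat set" where
  "vertical = {i. i < n \<and> S `` {i} = {}}"

lemma finite_S: "finite S"
  using S_subset by (rule finite_subset) (simp add: pretzel_crossings_def)

lemma A_above_c [simp]: "A_above i c = card (S `` {i})"
  using S_subset by (intro count_below_eq_card) (auto simp: pretzel_crossings_def)

lemma A_above_le: "l \<le> c \<Longrightarrow> A_above i l \<le> card (S `` {i})"
  using count_below_mono[of l c "S `` {i}"] by simp

lemma finite_vertical [simp]: "finite vertical"
  by (simp add: vertical_def)

lemma vertical_below_n [simp]: "count_below vertical n = card vertical"
  by (intro count_below_eq_card) (auto simp: vertical_def)

lemma loop_endpoint:
  assumes "i < n" "j < c" "p < 4"
  shows "loop (i, j, p) = loop (level_point i (j + p div 2) (p mod 2))"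
proof -
  consider "p < 2" | "p = 2 \<or> p = 3" "Suc j = c" | "p = 2" "Suc j < c" | "p = 3" "Suc j < c"
    using assms(2,3) by linarith
  then show ?thesis
  proof cases
    case 3
    then have "((i, j, p), (i, Suc j, 0)) \<in> edges"
      using assms(1) by (simp add: edges_def pretzel_arcs_def)
    then show ?thesis
      using 3 by (simp add: level_point_def loop_edge)
  next
    case 4
    then have "((i, j, p), (i, Suc j, 1)) \<in> edges"
      using assms(1) by (simp add: edges_def pretzel_arcs_def)
    then show ?thesis
      using 4 by (simp add: level_point_def loop_edge)
  qed (use assms(2) in \<open>auto simp: level_point_def simp del: add_2_eq_Suc'\<close>)
qed

lemma loop_B_smoothing:
  assumes "i < n" "j < c" "s < 2" "(i, j) \<notin> S"
  shows "loop (level_point i (Suc j) s) = loop (level_point i j s)"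
proof -
  have "loop (i, j, s + 2) = loop (level_point i (Suc j) s)"
    using loop_endpoint[of i j "s + 2"] assms by simp
  moreover have "((i, j, s), (i, j, s + 2)) \<in> edges"
    using assms by (auto simp: edges_def pretzel_smoothing_def pretzel_crossings_def less_2_cases_iff)
  ultimately show ?thesis
    using loop_edge assms(2) by (simp add: level_point_def)
qed

lemma loop_A_smoothing:
  assumes "(i, j) \<in> S"
  shows "loop (level_point i j 0) = loop (level_point i j 1)"
    and "loop (level_point i (Suc j) 0) = loop (level_point i (Suc j) 1)"
proof -
  have ij: "i < n" "j < c"
    using assms S_subset by (auto simp: pretzel_crossings_def)
  have "loop (i, j, 0) = loop (i, j, 1)" "loop (i, j, 2) = loop (i, j, 3)"
    using assms by (intro loop_edge; simp add: edges_def pretzel_smoothing_def)+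
  then show "loop (level_point i j 0) = loop (level_point i j 1)"
    "loop (level_point i (Suc j) 0) = loop (level_point i (Suc j) 1)"
    using loop_endpoint[OF ij, of 0] loop_endpoint[OF ij, of 1]
      loop_endpoint[OF ij, of 2] loop_endpoint[OF ij, of 3] by simp_all
qed

lemma loop_left_eq_right:
  assumes "i < n" "l \<le> c" "S `` {i} \<noteq> {}"
  shows "loop (level_point i l 0) = loop (level_point i l 1)"
proof -
  let ?P = "\<lambda>l. loop (level_point i l 0) = loop (level_point i l 1)"
  have step: "?P (Suc l) \<longleftrightarrow> ?P l" if "l < c" for l
    using loop_A_smoothing[of i l] loop_B_smoothing[OF assms(1) that] by (cases "(i, l) \<in> S") auto
  obtain j where "(i, j) \<in> S"
    using assms(3) by auto
  then have "?P j" "j < c"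
    using loop_A_smoothing(1) S_subset by (auto simp: pretzel_crossings_def)
  moreover have "?P l \<longleftrightarrow> ?P j"
    by (rule eq_if_steps_eq[of c ?P, OF step]) (use assms(2) \<open>j < c\<close> in auto)
  ultimately show ?thesis
    by blast
qed

lemma loop_eq_if_A_above_eq:
  assumes "i < n" "s < 2" "l \<le> c" "l' \<le> c" "A_above i l = A_above i l'"
  shows "loop (level_point i l s) = loop (level_point i l' s)"
proof (rule eq_if_count_below_eq[of c "S `` {i}" "\<lambda>l. loop (level_point i l s)"])
  show "loop (level_point i (Suc l) s) = loop (level_point i l s)" if "l < c" "l \<notin> S `` {i}" for l
    using that assms(1,2) by (intro loop_B_smoothing) auto
qed (fact assms)+

text \<open>The outer arcs at the top and at the bottom between the regions \<open>x - 1\<close> and \<open>x\<close>; the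
  positions \<open>0\<close> and \<open>n\<close> coincide.\<close>

definition top_loop :: "nat \<Rightarrow> endpoint set" where
  "top_loop x = loop (level_point (x mod n) 0 0)"

definition bottom_loop :: "nat \<Rightarrow> endpoint set" where
  "bottom_loop x = loop (level_point (x mod n) c 0)"

lemma top_loop_n: "top_loop n = top_loop 0"
  by (simp add: top_loop_def)

lemma loop_extreme_level:
  assumes "i < n" "s < 2"
  shows "loop (level_point i 0 s) = top_loop (i + s)" "loop (level_point i c s) = bottom_loop (i + s)"
proof -
  have "loop (level_point i 0 1) = top_loop (Suc i)" "loop (level_point i c 1) = bottom_loop (Suc i)"
    unfolding top_loop_def bottom_loop_def using assms c_pos
    by (auto simp: level_point_def edges_def pretzel_arcs_def numeral_3_eq_3 intro!: loop_edge)
  then show "loop (level_point i 0 s) = top_loop (i + s)" "loop (level_point i c s) = bottom_loop (i + s)"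
    using assms by (auto simp: top_loop_def bottom_loop_def less_2_cases_iff)
qed

lemma outer_loops_horizontal_region:
  assumes "i < n" "i \<notin> vertical"
  shows "top_loop (Suc i) = top_loop i" "bottom_loop (Suc i) = bottom_loop i"
proof -
  have "loop (level_point i 0 0) = loop (level_point i 0 1)"
    "loop (level_point i c 0) = loop (level_point i c 1)"
    using assms by (intro loop_left_eq_right; simp add: vertical_def)+
  then show "top_loop (Suc i) = top_loop i" "bottom_loop (Suc i) = bottom_loop i"
    using loop_extreme_level[OF assms(1), of 0] loop_extreme_level[OF assms(1), of 1] by auto
qed

lemma outer_loops_vertical_region:
  assumes "i \<in> vertical"
  shows "top_loop i = bottom_loop i" "top_loop (Suc i) = bottom_loop (Suc i)"
proof -
  have i: "i < n" "A_above i 0 = A_above i c"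
    using assms by (auto simp: vertical_def)
  then have "loop (level_point i 0 0) = loop (level_point i c 0)"
    "loop (level_point i 0 1) = loop (level_point i c 1)"
    by (intro loop_eq_if_A_above_eq; simp)+
  then show "top_loop i = bottom_loop i" "top_loop (Suc i) = bottom_loop (Suc i)"
    using loop_extreme_level[OF i(1), of 0] loop_extreme_level[OF i(1), of 1] by auto
qed

lemma outer_loops_eq_if_no_vertical:
  assumes "vertical = {}" "x \<le> n" "y \<le> n"
  shows "top_loop x = top_loop y" "bottom_loop x = bottom_loop y"
  by (rule eq_if_steps_eq[OF _ assms(2,3)]; simp add: outer_loops_horizontal_region assms(1))+

lemma top_loop_eq_bottom_loop:
  assumes "vertical \<noteq> {}" "x \<le> n"
  shows "top_loop x = bottom_loop x"
proof -
  let ?P = "\<lambda>x. top_loop x = bottom_loop x"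
  have step: "?P (Suc x) \<longleftrightarrow> ?P x" if "x < n" for x
    using outer_loops_horizontal_region[OF that] outer_loops_vertical_region[of x]
    by (cases "x \<in> vertical") auto
  obtain i where "i \<in> vertical"
    using assms(1) by blast
  then have "?P i" "i < n"
    using outer_loops_vertical_region(1) by (auto simp: vertical_def)
  moreover have "?P x \<longleftrightarrow> ?P i"
    by (rule eq_if_steps_eq[of n ?P, OF step]) (use assms(2) \<open>i < n\<close> in auto)
  ultimately show ?thesis
    by blast
qed

lemma top_loop_eq_if_mod_eq:
  assumes "x \<le> n" "y \<le> n"
    and "count_below vertical x mod card vertical = count_below vertical y mod card vertical"
  shows "top_loop x = top_loop y"
proof -
  have same_count: "top_loop x = top_loop y"
    if "x \<le> n" "y \<le> n" "count_below vertical x = count_below vertical y" for x y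
    by (rule eq_if_count_below_eq[of n vertical top_loop, OF outer_loops_horizontal_region(1) that])
  have "\<exists>x'\<le>n. top_loop x' = top_loop x \<and>
      count_below vertical x' = count_below vertical x mod card vertical" if "x \<le> n" for x
  proof (cases "count_below vertical x = card vertical")
    case True
    then have "top_loop 0 = top_loop x"
      using same_count[of n x] that top_loop_n by simp
    then show ?thesis
      using True by auto
  next
    case False
    then have "count_below vertical x < card vertical"
      using count_below_mono[OF that, of vertical] by simp
    then show ?thesis
      using that by auto
  qed
  from this[OF assms(1)] this[OF assms(2)] show ?thesis
    using same_count assms(3) by metis
qed

end

text \<open>\<open>Inner i k\<close> is the loop between the \<open>k\<close>-th and the next A-smoothing of region \<open>i\<close>, and \<open>Outer m\<close> the
  loop between the \<open>m\<close>-th and the next vertical region.\<close>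

datatype loop_label = Inner nat nat | Top | Bottom | Outer nat

context pretzel_state
begin

definition inner_level :: "nat \<Rightarrow> nat \<Rightarrow> bool" where
  "inner_level i l \<longleftrightarrow> 0 < A_above i l \<and> A_above i l < card (S `` {i})"

definition level_label :: "nat \<Rightarrow> nat \<Rightarrow> nat \<Rightarrow> loop_label" where
  "level_label i l s =
     (if inner_level i l then Inner i (A_above i l)
      else if vertical = {} then (if A_above i l = 0 then Top else Bottom)
      else Outer (count_below vertical (i + s) mod card vertical))"

lemma level_label_eq_Inner_iff:
  "level_label i l s = Inner i' k \<longleftrightarrow> inner_level i l \<and> i' = i \<and> k = A_above i l"
  by (auto simp: level_label_def)

fun endpoint_label :: "endpoint \<Rightarrow> loop_label" where
  "endpoint_label (i, j, p) = level_label i (j + p div 2) (p mod 2)"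

lemma endpoint_label_edge:
  assumes "(x, y) \<in> edges"
  shows "endpoint_label x = endpoint_label y"
proof -
  have wrap: "count_below vertical (Suc i) mod card vertical =
      count_below vertical (Suc i mod n) mod card vertical" if "i < n" for i
    using that by (cases "Suc i = n") (auto simp del: count_below_Suc)
  have not_vertical: "i \<notin> vertical" if "(i, j) \<in> S" for i j
    using that by (auto simp: vertical_def)
  show ?thesis
    using assms unfolding edges_def pretzel_arcs_def pretzel_smoothing_def
  proof (elim UnE CollectE exE conjE)
    fix i assume i: "(x, y) = ((i, 0, 1), (Suc i mod n, 0, 0))" "i < n"
    then show ?thesis
      using wrap by (simp add: level_label_def inner_level_def del: count_below_Suc)
  next
    fix i assume i: "(x, y) = ((i, c - 1, 3), (Suc i mod n, c - 1, 2))" "i < n"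
    have bottom: "level_label i c s = (if vertical = {} then Bottom
        else Outer (count_below vertical (i + s) mod card vertical))" if "i < n" for i s
      using that finite_S by (auto simp: level_label_def inner_level_def vertical_def)
    have "level_label i c 1 = level_label (Suc i mod n) c 0"
      using n_pos i(2) wrap[of i] by (simp add: bottom del: count_below_Suc)
    then show ?thesis
      using i(1) c_pos by simp
  qed (auto simp: level_label_def inner_level_def not_vertical)
qed

lemma loop_outer_level:
  assumes "i < n" "l \<le> c" "s < 2" "\<not> inner_level i l"
  shows "loop (level_point i l s) = (if A_above i l = 0 then top_loop (i + s) else bottom_loop (i + s))"
proof (cases "A_above i l = 0")
  case True
  then show ?thesis
    using loop_eq_if_A_above_eq[OF assms(1,3,2), of 0] loop_extreme_level(1)[OF assms(1,3)] by simp
next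
  case False
  then have "A_above i l = A_above i c"
    using assms(4) A_above_le[OF assms(2), of i] by (simp add: inner_level_def)
  then show ?thesis
    using False loop_eq_if_A_above_eq[OF assms(1,3,2), of c] loop_extreme_level(2)[OF assms(1,3)] by simp
qed

lemma loop_inner_level:
  assumes "i < n" "l \<le> c" "l' \<le> c" "s < 2" "s' < 2" "inner_level i l" "A_above i l' = A_above i l"
  shows "loop (level_point i l s) = loop (level_point i l' s')"
proof -
  have "S `` {i} \<noteq> {}"
    using assms(6) by (auto simp: inner_level_def)
  then have "loop (level_point i l s) = loop (level_point i l s')"
    using loop_left_eq_right[OF assms(1,2)] assms(4,5) by (auto simp: less_2_cases_iff)
  then show ?thesis
    using loop_eq_if_A_above_eq[of i s' l l'] assms by simp
qed

lemma loop_eq_if_level_label_eq: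
  assumes x: "i < n" "l \<le> c" "s < 2" and y: "i' < n" "l' \<le> c" "s' < 2"
    and eq: "level_label i l s = level_label i' l' s'"
  shows "loop (level_point i l s) = loop (level_point i' l' s')"
proof (cases "inner_level i l")
  case True
  then have "level_label i' l' s' = Inner i (A_above i l)"
    unfolding eq[symmetric] by (simp add: level_label_def)
  then have "i' = i" "A_above i l' = A_above i l"
    by (auto simp: level_label_eq_Inner_iff)
  then show ?thesis
    using loop_inner_level[OF x(1,2) y(2) x(3) y(3) True] by simp
next
  case False
  then have False': "\<not> inner_level i' l'"
    using eq level_label_eq_Inner_iff by metis
  note labels = level_label_def[of i l s, unfolded if_not_P[OF False]]
    level_label_def[of i' l' s', unfolded if_not_P[OF False']]
  note loops = loop_outer_level[OF x False] loop_outer_level[OF y False']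
  have bounds: "i + s \<le> n" "i' + s' \<le> n"
    using x y by linarith+
  show ?thesis
  proof (cases "vertical = {}")
    case True
    then have "A_above i l = 0 \<longleftrightarrow> A_above i' l' = 0"
      using eq labels by (simp split: if_splits)
    then show ?thesis
      using loops outer_loops_eq_if_no_vertical[OF True bounds] by simp
  next
    case nonempty: False
    then have "count_below vertical (i + s) mod card vertical =
        count_below vertical (i' + s') mod card vertical"
      using eq labels by simp
    then have "top_loop (i + s) = top_loop (i' + s')"
      by (rule top_loop_eq_if_mod_eq[OF bounds])
    moreover have "top_loop (i + s) = bottom_loop (i + s)" "top_loop (i' + s') = bottom_loop (i' + s')"
      using top_loop_eq_bottom_loop[OF nonempty] bounds by blast+
    ultimately show ?thesis
      using loops by simp
  qed
qed

definition levels :: "(nat \<times> nat \<times> nat) set" where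
  "levels = {..<n} \<times> {..c} \<times> {..<2}"

lemma levels_eq_image_endpoints:
  "levels = (\<lambda>(i, j, p). (i, j + p div 2, p mod 2)) ` pretzel_endpoints n c"
proof (intro equalityI subsetI)
  fix x assume "x \<in> levels"
  then obtain i l s where x: "x = (i, l, s)" "i < n" "l \<le> c" "s < 2"
    by (auto simp: levels_def)
  show "x \<in> (\<lambda>(i, j, p). (i, j + p div 2, p mod 2)) ` pretzel_endpoints n c"
  proof (cases "l < c")
    case True
    then show ?thesis
      using x by (intro image_eqI[of _ _ "(i, l, s)"]) (auto simp: pretzel_endpoints_def)
  next
    case False
    then show ?thesis
      using x c_pos by (intro image_eqI[of _ _ "(i, c - 1, s + 2)"]) (auto simp: pretzel_endpoints_def)
  qed
qed (auto simp: levels_def pretzel_endpoints_def)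

definition labels :: "loop_label set" where
  "labels = (\<lambda>(i, l, s). level_label i l s) ` levels"

lemma level_label_in_labels: "i < n \<Longrightarrow> l \<le> c \<Longrightarrow> s < 2 \<Longrightarrow> level_label i l s \<in> labels"
  unfolding labels_def by (intro image_eqI[of _ _ "(i, l, s)"]) (simp_all add: levels_def)

lemma pretzel_loops_eq_card_labels: "pretzel_loops n c S = card labels"
proof -
  have "loop x = loop y \<longleftrightarrow> endpoint_label x = endpoint_label y"
    if xy: "x \<in> pretzel_endpoints n c" "y \<in> pretzel_endpoints n c" for x y
  proof
    assume eq: "endpoint_label x = endpoint_label y"
    obtain i j p i' j' p' where "x = (i, j, p)" "y = (i', j', p')"
      and ij: "i < n" "j < c" "p < 4" "i' < n" "j' < c" "p' < 4"
      using xy by (auto simp: pretzel_endpoints_def)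
    moreover have "j + p div 2 \<le> c" "j' + p' div 2 \<le> c"
      using ij by linarith+
    ultimately show "loop x = loop y"
      using eq loop_eq_if_level_label_eq[of i "j + p div 2" "p mod 2" i' "j' + p' div 2" "p' mod 2"]
      by (simp add: loop_endpoint)
  qed (rule loop_invariant, assumption, rule endpoint_label_edge)
  then have "pretzel_loops n c S = card (endpoint_label ` pretzel_endpoints n c)"
    unfolding pretzel_loops_eq_card_loop by (rule card_image_eq_card_image)
  also have "endpoint_label ` pretzel_endpoints n c = labels"
    unfolding labels_def levels_eq_image_endpoints image_image by (intro image_cong refl) auto
  finally show ?thesis .
qed

definition inner_labels :: "loop_label set" where
  "inner_labels = (\<lambda>(i, k). Inner i k) ` (SIGMA i:{..<n}. {0<..<card (S `` {i})})"

definition outer_labels :: "loop_label set" where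
  "outer_labels = (if vertical = {} then {Top, Bottom} else Outer ` {..<card vertical})"

lemma labels_subset: "labels \<subseteq> inner_labels \<union> outer_labels"
proof
  fix v assume "v \<in> labels"
  then obtain i l s where v: "v = level_label i l s" "i < n"
    by (auto simp: labels_def levels_def)
  show "v \<in> inner_labels \<union> outer_labels"
  proof (cases "inner_level i l")
    case True
    then have "v = (\<lambda>(i, k). Inner i k) (i, A_above i l)"
      by (simp add: v(1) level_label_def)
    then show ?thesis
      unfolding inner_labels_def using True v(2) by (intro UnI1 image_eqI) (auto simp: inner_level_def)
  next
    case False
    then show ?thesis
      by (simp add: v(1) level_label_def outer_labels_def card_gt_0_iff)
  qed
qed

lemma inner_labels_subset: "inner_labels \<subseteq> labels"
proof
  fix v assume "v \<in> inner_labels"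
  then obtain i k where v: "v = Inner i k" "i < n" "0 < k" "k < card (S `` {i})"
    by (auto simp: inner_labels_def)
  obtain l where l: "l \<le> c" "A_above i l = k"
    using count_below_attained[of k "S `` {i}" c] v(4) by auto
  then have "level_label i l 0 = v"
    using v by (simp add: level_label_def inner_level_def)
  then show "v \<in> labels"
    using level_label_in_labels[of i l 0] v(2) l(1) by simp
qed

lemma outer_labels_subset: "outer_labels \<subseteq> labels"
proof
  fix v assume "v \<in> outer_labels"
  then consider "vertical = {}" "v = Top" | "vertical = {}" "v = Bottom"
    | m where "vertical \<noteq> {}" "v = Outer m" "m < card vertical"
    by (auto simp: outer_labels_def split: if_splits)
  then show "v \<in> labels"
  proof cases
    case 1
    then have "level_label 0 0 0 = v"
      by (simp add: level_label_def inner_level_def)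
    then show ?thesis
      using level_label_in_labels[of 0 0 0] n_pos by simp
  next
    case 2
    then have "level_label 0 c 0 = v"
      using n_pos finite_S by (auto simp: level_label_def inner_level_def vertical_def)
    then show ?thesis
      using level_label_in_labels[of 0 c 0] n_pos by simp
  next
    case (3 m)
    obtain x where x: "x \<le> n" "count_below vertical x = m"
      using count_below_attained[of m vertical n] 3(3) by auto
    then have "x < n"
      using 3(3) by (auto simp: le_less)
    moreover have "level_label x 0 0 = v"
      using 3 x(2) by (simp add: level_label_def inner_level_def)
    ultimately show ?thesis
      using level_label_in_labels[of x 0 0] by simp
  qed
qed

theorem pretzel_loops_eq:
  "pretzel_loops n c S =
     (\<Sum>i<n. card (S `` {i}) - 1) + (if vertical = {} then 2 else card vertical)"
proof -
  have "labels = inner_labels \<union> outer_labels"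
    using labels_subset inner_labels_subset outer_labels_subset by blast
  then have "pretzel_loops n c S = card inner_labels + card outer_labels"
    unfolding pretzel_loops_eq_card_labels
    by (simp only:) (rule card_Un_disjoint, auto simp: inner_labels_def outer_labels_def finite_S)
  also have "card inner_labels = (\<Sum>i<n. card (S `` {i}) - 1)"
    unfolding inner_labels_def by (subst card_image) (auto simp: inj_on_def)
  also have "card outer_labels = (if vertical = {} then 2 else card vertical)"
    by (auto simp: outer_labels_def card_image inj_on_def)
  finally show ?thesis .
qed

end

section \<open>The Kauffman bracket\<close>

definition region_weight :: "'a \<Rightarrow> 'a \<Rightarrow> 'a \<Rightarrow> 'b set \<Rightarrow> 'a :: comm_ring_1" where
  "region_weight a d v T = a ^ card T * (if T = {} then v else d ^ (card T - 1))"

lemma sum_Pow_power_card: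
  fixes x :: "'a :: comm_semiring_1"
  assumes "finite C"
  shows "(\<Sum>T\<in>Pow C. x ^ card T) = (1 + x) ^ card C"
  using prod_add[OF assms, of "\<lambda>_. x" "\<lambda>_. 1"] by (simp add: add.commute)

lemma sum_region_weight:
  assumes "finite C"
  shows "d * (\<Sum>T\<in>Pow C. region_weight a d v T) = (1 + a * d) ^ card C - 1 + d * v"
proof -
  have "d * region_weight a d v T = (a * d) ^ card T + (if T = {} then d * v - 1 else 0)"
    if "T \<in> Pow C" for T
  proof (cases "T = {}")
    case False
    then have "card T > 0"
      using that assms by (auto simp: card_gt_0_iff intro: finite_subset)
    then have "d ^ card T = d * d ^ (card T - 1)"
      by (simp add: power_eq_if)
    then show ?thesis
      using False by (simp add: region_weight_def power_mult_distrib mult_ac)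
  qed (simp add: region_weight_def)
  then have "d * (\<Sum>T\<in>Pow C. region_weight a d v T) =
      (\<Sum>T\<in>Pow C. (a * d) ^ card T + (if T = {} then d * v - 1 else 0))"
    unfolding sum_distrib_left by (rule sum.cong[OF refl])
  then show ?thesis
    using assms by (simp add: sum.distrib sum_Pow_power_card)
qed

lemma sum_Pow_Times_prod:
  fixes f :: "'b set \<Rightarrow> 'c :: comm_semiring_1"
  assumes "finite I" "finite C"
  shows "(\<Sum>S\<in>Pow (I \<times> C). \<Prod>i\<in>I. f (S `` {i})) = (\<Sum>T\<in>Pow C. f T) ^ card I"
proof -
  have "(\<Sum>S\<in>Pow (I \<times> C). \<Prod>i\<in>I. f (S `` {i})) = (\<Sum>g\<in>PiE I (\<lambda>_. Pow C). \<Prod>i\<in>I. f (g i))"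
    by (rule sum.reindex_bij_witness[of _ "\<lambda>g. Sigma I g" "\<lambda>S. \<lambda>i\<in>I. S `` {i}"])
      (auto simp: PiE_iff extensional_def fun_eq_iff restrict_def Image_def intro!: prod.cong)
  also have "\<dots> = (\<Sum>T\<in>Pow C. f T) ^ card I"
    using assms by (subst prod_sum_PiE[symmetric]) auto
  finally show ?thesis .
qed

context pretzel_state
begin

lemma card_S: "card S = (\<Sum>i<n. card (S `` {i}))"
proof -
  have "S = (SIGMA i:{..<n}. S `` {i})"
    using S_subset by (auto simp: pretzel_crossings_def)
  moreover have "card (SIGMA i:{..<n}. S `` {i}) = (\<Sum>i<n. card (S `` {i}))"
    using finite_S by (intro card_SigmaI) auto
  ultimately show ?thesis
    by simp
qed

text \<open>The first product is what the loop count with a vertical region would give for every state;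
  the second one vanishes unless there is no vertical region, when it corrects \<open>d\<^sup>0\<close> to \<open>d\<^sup>2\<close>.\<close>

lemma power_pretzel_loops:
  fixes d :: "'a :: comm_ring_1"
  shows "d ^ pretzel_loops n c S =
    (\<Prod>i<n. if S `` {i} = {} then d else d ^ (card (S `` {i}) - 1)) +
    (d\<^sup>2 - 1) * (\<Prod>i<n. if S `` {i} = {} then 0 else d ^ (card (S `` {i}) - 1))"
    (is "_ = ?with_vertical + _ * ?without_vertical")
proof (cases "vertical = {}")
  case True
  then have "S `` {i} \<noteq> {}" if "i < n" for i
    using that by (auto simp: vertical_def)
  then have "?with_vertical = (\<Prod>i<n. d ^ (card (S `` {i}) - 1))"
    "?without_vertical = (\<Prod>i<n. d ^ (card (S `` {i}) - 1))"
    by (auto intro!: prod.cong)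
  then show ?thesis
    using True by (simp add: pretzel_loops_eq power_add power_sum algebra_simps power2_eq_square)
next
  case False
  then obtain i where "i < n" "S `` {i} = {}"
    by (auto simp: vertical_def)
  then have "?without_vertical = 0"
    by (intro prod_zero bexI[of _ i]) auto
  moreover have "?with_vertical =
      (\<Prod>i<n. d ^ (card (S `` {i}) - 1)) * (\<Prod>i<n. if i \<in> vertical then d else 1)"
    unfolding prod.distrib[symmetric] by (intro prod.cong) (auto simp: vertical_def)
  moreover have "{..<n} \<inter> vertical = vertical"
    by (auto simp: vertical_def)
  ultimately show ?thesis
    using False by (simp add: pretzel_loops_eq power_add power_sum prod.If_cases Collect_mem_eq)
qed

lemma state_weight_eq_region_weights:
  fixes a d :: "'a :: comm_ring_1"
  shows "a ^ card S * d ^ pretzel_loops n c S =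
    (\<Prod>i<n. region_weight a d d (S `` {i})) + (d\<^sup>2 - 1) * (\<Prod>i<n. region_weight a d 0 (S `` {i}))"
  unfolding power_pretzel_loops region_weight_def prod.distrib card_S power_sum
  by (simp add: algebra_simps)

lemma state_term_mult:
  fixes A d :: complex
  assumes "A \<noteq> 0"
  shows "A powi (int (card S) - int (card (pretzel_crossings n c - S))) *
      d ^ (pretzel_loops n c S - 1) * (d * A ^ (n * c)) = (A\<^sup>2) ^ card S * d ^ pretzel_loops n c S"
proof -
  have "card (pretzel_crossings n c - S) + card S = n * c"
    using card_Diff_subset[OF finite_S S_subset] card_mono[OF _ S_subset]
    by (auto simp: pretzel_crossings_def)
  then have exponent:
    "int (card S) - int (card (pretzel_crossings n c - S)) + int (n * c) = int (2 * card S)"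
    by linarith
  have "A powi int (2 * card S) =
      A powi (int (card S) - int (card (pretzel_crossings n c - S))) * A powi int (n * c)"
    unfolding exponent[symmetric] using assms by (intro power_int_add) simp
  then have "A powi (int (card S) - int (card (pretzel_crossings n c - S))) * A ^ (n * c) =
      (A\<^sup>2) ^ card S"
    by (simp only: power_int_of_nat power_mult)
  moreover have "pretzel_loops n c S > 0"
    by (auto simp: pretzel_loops_eq card_gt_0_iff)
  then have "d ^ pretzel_loops n c S = d ^ (pretzel_loops n c S - 1) * d"
    by (simp add: power_eq_if)
  ultimately show ?thesis
    by (simp add: ac_simps)
qed

end

lemma pretzel_bracket_eq_region_sums:
  fixes A :: complex
  assumes "n > 0" "c > 0" "A \<noteq> 0" and d: "d = - (A\<^sup>2) - inverse (A\<^sup>2)"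
  shows "pretzel_bracket n c A * (d * A ^ (n * c)) =
    (\<Sum>T\<in>Pow {..<c}. region_weight (A\<^sup>2) d d T) ^ n +
    (d\<^sup>2 - 1) * (\<Sum>T\<in>Pow {..<c}. region_weight (A\<^sup>2) d 0 T) ^ n"
proof -
  have "pretzel_bracket n c A * (d * A ^ (n * c)) = (\<Sum>S\<in>Pow (pretzel_crossings n c).
      (\<Prod>i<n. region_weight (A\<^sup>2) d d (S `` {i})) + (d\<^sup>2 - 1) * (\<Prod>i<n. region_weight (A\<^sup>2) d 0 (S `` {i})))"
    unfolding pretzel_bracket_def sum_distrib_right d[symmetric]
  proof (rule sum.cong[OF refl])
    fix S assume "S \<in> Pow (pretzel_crossings n c)"
    then interpret pretzel_state n c S
      using assms(1,2) by unfold_locales auto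
    show "A powi (int (card S) - int (card (pretzel_crossings n c - S))) *
        d ^ (pretzel_loops n c S - 1) * (d * A ^ (n * c)) =
        (\<Prod>i<n. region_weight (A\<^sup>2) d d (S `` {i})) + (d\<^sup>2 - 1) * (\<Prod>i<n. region_weight (A\<^sup>2) d 0 (S `` {i}))"
      unfolding state_term_mult[OF assms(3)] by (rule state_weight_eq_region_weights)
  qed
  also have "\<dots> = (\<Sum>T\<in>Pow {..<c}. region_weight (A\<^sup>2) d d T) ^ n +
      (d\<^sup>2 - 1) * (\<Sum>T\<in>Pow {..<c}. region_weight (A\<^sup>2) d 0 T) ^ n"
    unfolding pretzel_crossings_def sum.distrib sum_distrib_left[symmetric] atLeast0LessThan
    by (simp add: sum_Pow_Times_prod)
  finally show ?thesis .
qed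

lemma pretzel_bracket_closed_form:
  fixes A :: complex
  assumes "n > 0" "c > 0" "A \<noteq> 0" and d: "d = - (A\<^sup>2) - inverse (A\<^sup>2)"
  shows "pretzel_bracket n c A * (A ^ (n * c) * d ^ Suc n) =
    (d\<^sup>2 - 1 + (- (A ^ 4)) ^ c) ^ n + (d\<^sup>2 - 1) * ((- (A ^ 4)) ^ c - 1) ^ n"
proof -
  have "1 + A\<^sup>2 * d = - (A ^ 4)"
    using assms(3) by (simp add: d field_simps power2_eq_square power4_eq_xxxx)
  then have sum: "d * (\<Sum>T\<in>Pow {..<c}. region_weight (A\<^sup>2) d v T) = (- (A ^ 4)) ^ c - 1 + d * v" for v
    by (simp add: sum_region_weight)
  have "pretzel_bracket n c A * (A ^ (n * c) * d ^ Suc n) =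
      pretzel_bracket n c A * (d * A ^ (n * c)) * d ^ n"
    by simp
  also have "\<dots> = (d * (\<Sum>T\<in>Pow {..<c}. region_weight (A\<^sup>2) d d T)) ^ n +
      (d\<^sup>2 - 1) * (d * (\<Sum>T\<in>Pow {..<c}. region_weight (A\<^sup>2) d 0 T)) ^ n"
    unfolding pretzel_bracket_eq_region_sums[OF assms] by (simp add: power_mult_distrib algebra_simps)
  finally show ?thesis
    unfolding sum by (simp add: power2_eq_square algebra_simps)
qed

section \<open>Mahler measure and Jensen's formula\<close>

definition mahler_measure :: "complex poly \<Rightarrow> real" where
  "mahler_measure p = cmod (lead_coeff p) * (\<Prod>z\<in>#proots p. max 1 (cmod z))"

lemma complex_poly_linear_factors:
  fixes p :: "complex poly"
  obtains r where "\<And>s. poly p s = lead_coeff p * (\<Prod>i<degree p. s - r i)"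
    and "mahler_measure p = cmod (lead_coeff p) * (\<Prod>i<degree p. max 1 (cmod (r i)))"
proof -
  obtain r where factors: "smult (lead_coeff p) (\<Prod>i<degree p. [:- r i, 1:]) = p"
    using complex_poly_decompose' .
  have "poly p s = lead_coeff p * (\<Prod>i<degree p. s - r i)" for s
    by (subst factors[symmetric]) (simp add: poly_prod)
  moreover have "proots p = (\<Sum>i<degree p. {#r i#})" if "p \<noteq> 0"
    by (subst factors[symmetric], use that in \<open>simp add: proots_prod\<close>)
  then have "mahler_measure p = cmod (lead_coeff p) * (\<Prod>i<degree p. max 1 (cmod (r i)))"
    by (cases "p = 0") (simp_all add: mahler_measure_def prod_unfold_prod_mset sum_unfold_sum_mset
        image_mset.compositionality comp_def)
  ultimately show ?thesis
    using that by blast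
qed

lemma mahler_measure_nonneg: "0 \<le> mahler_measure p"
  by (rule complex_poly_linear_factors[of p]) (simp add: prod_nonneg)

lemma mahler_measure_pos: "p \<noteq> 0 \<Longrightarrow> 0 < mahler_measure p"
  by (rule complex_poly_linear_factors[of p]) (simp add: prod_pos less_max_iff_disj)

lemma has_integral_circle_mean:
  assumes "continuous_on (cball z r) f" "f holomorphic_on ball z r" "r > 0"
  shows "((\<lambda>x. f (z + of_real r * cis (2 * pi * x))) has_integral f z) {0..1}"
proof -
  have "((\<lambda>u. f u / (u - z)) has_contour_integral (2 * of_real pi * \<i> * f z)) (circlepath z r)"
    using assms by (intro Cauchy_integral_circlepath) auto
  then have "((\<lambda>x. 2 * of_real pi * \<i> * f (z + of_real r * cis (2 * pi * x))) has_integral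
      2 * of_real pi * \<i> * f z) {0..1}"
    unfolding has_contour_integral_def
  proof (rule has_integral_eq[rotated])
    fix x :: real assume x: "x \<in> {0..1}"
    have path: "circlepath z r x = z + of_real r * cis (2 * pi * x)"
      by (simp add: circlepath cis_conv_exp mult_ac)
    have "vector_derivative (circlepath z r) (at x within {0..1}) =
        2 * of_real pi * \<i> * of_real r * cis (2 * pi * x)"
      using x by (simp add: vector_derivative_circlepath01 cis_conv_exp mult_ac)
    then show "f (circlepath z r x) / (circlepath z r x - z) *
        vector_derivative (circlepath z r) (at x within {0..1}) =
        2 * of_real pi * \<i> * f (z + of_real r * cis (2 * pi * x))"
      using assms(3) by (simp add: path)
  qed
  from has_integral_mult_right[OF this, of "1 / (2 * of_real pi * \<i>)"] show ?thesis
    by simp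
qed

lemma finite_circle_roots:
  fixes p :: "complex poly"
  assumes "p \<noteq> 0"
  shows "finite {x \<in> {0..1}. poly p (cis (2 * pi * x)) = 0}"
proof -
  have "inj_on (\<lambda>x. cis (2 * pi * x)) {0..<1}"
  proof (rule inj_on_inverseI)
    fix x :: real assume "x \<in> {0..<1}"
    then have "Arg2pi (cis (2 * pi * x)) = 2 * pi * x"
      by (intro Arg2pi_unique[of 1]) (auto simp: cis_conv_exp)
    then show "Arg2pi (cis (2 * pi * x)) / (2 * pi) = x"
      by simp
  qed
  from finite_vimage_IntI[OF poly_roots_finite[OF assms] this]
  have "finite (insert 1 ((\<lambda>x. cis (2 * pi * x)) -` {z. poly p z = 0} \<inter> {0..<1}))"
    by simp
  then show ?thesis
    by (rule finite_subset[rotated]) auto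
qed

lemma has_integral_ln_cmod_one_minus_interior:
  assumes "cmod b < 1"
  shows "((\<lambda>x. ln (cmod (1 - b * cis (2 * pi * x)))) has_integral 0) {0..1}"
proof -
  have pos: "0 < Re (1 - b * z)" if "cmod z \<le> 1" for z
  proof -
    have "cmod (b * z) < 1"
      using assms that mult_left_le[of "cmod z" "cmod b"] by (simp add: norm_mult)
    then show ?thesis
      using complex_Re_le_cmod[of "b * z"] by simp
  qed
  have "((\<lambda>x. Ln (1 - b * (0 + of_real 1 * cis (2 * pi * x)))) has_integral Ln (1 - b * 0)) {0..1}"
    using pos by (intro has_integral_circle_mean continuous_intros holomorphic_intros)
      (auto simp: complex_nonpos_Reals_iff not_le less_imp_le)
  from has_integral_linear[OF this bounded_linear_Re]
  have "((\<lambda>x. Re (Ln (1 - b * cis (2 * pi * x)))) has_integral 0) {0..1}"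
    by (simp add: comp_def)
  moreover have "1 - b * cis (2 * pi * x) \<noteq> 0" for x
    using pos[of "cis (2 * pi * x)"] by (metis less_irrefl norm_cis order_refl zero_complex.sel(1))
  ultimately show ?thesis
    by simp
qed

text \<open>The correction by \<open>ln r / 2\<close> makes the family monotone in the radius, so that the boundary case of
  the integral below follows from the interior one by monotone convergence.\<close>

lemma ln_cmod_one_minus_of_real_mult_antimono:
  fixes w :: complex
  assumes "cmod w = 1" "w \<noteq> 1" "0 < r" "r \<le> r'" "r' \<le> 1"
  shows "ln (cmod (1 - of_real r' * w)) - ln r' / 2 \<le> ln (cmod (1 - of_real r * w)) - ln r / 2"
proof -
  have expand: "(cmod (1 - of_real t * w))\<^sup>2 / t = 1 / t + t - 2 * Re w" if "t > 0" for t
  proof -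
    have "(cmod (1 - of_real t * w))\<^sup>2 = 1 - 2 * t * Re w + t\<^sup>2 * (cmod w)\<^sup>2"
      unfolding cmod_power2 by (simp add: power2_eq_square algebra_simps)
    then show ?thesis
      using assms(1) that by (simp add: field_simps power2_eq_square)
  qed
  have pos: "0 < cmod (1 - of_real t * w)" if "t > 0" for t
  proof -
    have "of_real t * w \<noteq> 1"
    proof
      assume eq: "of_real t * w = 1"
      have "t = cmod (of_real t * w)"
        using assms(1) that by (simp add: norm_mult)
      then show False
        using eq assms(2) by simp
    qed
    then show ?thesis
      by simp
  qed
  have "0 \<le> (r' - r) * (1 - r * r') / (r * r')"
    using assms by (intro divide_nonneg_nonneg mult_nonneg_nonneg) (auto simp: mult_le_one)
  also have "\<dots> = (1 / r + r) - (1 / r' + r')"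
    using assms by (simp add: field_simps)
  finally have "(cmod (1 - of_real r' * w))\<^sup>2 / r' \<le> (cmod (1 - of_real r * w))\<^sup>2 / r"
    using assms by (simp add: expand)
  then have "ln ((cmod (1 - of_real r' * w))\<^sup>2 / r') \<le> ln ((cmod (1 - of_real r * w))\<^sup>2 / r)"
    using assms pos[of r'] by (intro ln_mono) auto
  then show ?thesis
    using assms pos[of r] pos[of r'] by (simp add: ln_div ln_realpow)
qed

lemma has_integral_ln_cmod_one_minus_of_real_mult:
  assumes "cmod b = 1" "0 < r" "r < 1"
  shows "((\<lambda>x. if b * cis (2 * pi * x) = 1 then 0
      else ln (cmod (1 - of_real r * (b * cis (2 * pi * x)))) - ln r / 2) has_integral - ln r / 2) {0..1}"
proof -
  have "b * cis (2 * pi * x) = 1 \<longleftrightarrow> poly [:1, - b:] (cis (2 * pi * x)) = 0" for x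
    by (auto simp: mult.commute)
  then have fin: "finite {x \<in> {0..1}. b * cis (2 * pi * x) = 1}"
    using finite_circle_roots[of "[:1, - b:]"] by simp
  have "((\<lambda>x. ln (cmod (1 - of_real r * (b * cis (2 * pi * x))))) has_integral 0) {0..1}"
    using has_integral_ln_cmod_one_minus_interior[of "of_real r * b"] assms
    by (simp add: norm_mult mult.assoc)
  from has_integral_diff[OF this has_integral_const_real[of "ln r / 2" 0 1]]
  have "((\<lambda>x. ln (cmod (1 - of_real r * (b * cis (2 * pi * x)))) - ln r / 2)
      has_integral - ln r / 2) {0..1}"
    by simp
  then show ?thesis
    by (rule has_integral_spike_finite[OF fin, rotated]) simp
qed

lemma has_integral_ln_cmod_one_minus_boundary:
  assumes b: "cmod b = 1"
  shows "((\<lambda>x. ln (cmod (1 - b * cis (2 * pi * x)))) has_integral 0) {0..1}"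
proof -
  define w where "w x = b * cis (2 * pi * x)" for x
  define r where "r k = 1 - 1 / (real k + 2)" for k
  define f where
    "f k x = (if w x = 1 then 0 else ln (cmod (1 - of_real (r k) * w x)) - ln (r k) / 2)" for k x
  have r: "0 < r k" "r k < 1" "r k \<le> r (Suc k)" for k
    unfolding r_def by (auto intro!: diff_left_mono divide_left_mono simp: divide_less_eq)
  have r_lim: "r \<longlonglongrightarrow> 1"
    unfolding r_def by real_asymp
  have norm_w: "cmod (w x) = 1" for x
    using b by (simp add: w_def norm_mult)
  have int_f: "(f k has_integral - ln (r k) / 2) {0..1}" for k
    unfolding f_def w_def by (rule has_integral_ln_cmod_one_minus_of_real_mult[OF b r(1,2)])
  have decreasing: "f (Suc k) x \<le> f k x" for k x
    using ln_cmod_one_minus_of_real_mult_antimono[OF norm_w _ r(1,3), of x k] r(2)[of "Suc k"]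
    by (simp add: f_def)
  have lim: "(\<lambda>k. f k x) \<longlonglongrightarrow> ln (cmod (1 - w x))" for x
  proof (cases "w x = 1")
    case False
    then have "(\<lambda>k. ln (cmod (1 - of_real (r k) * w x)) - ln (r k) / 2) \<longlonglongrightarrow>
        ln (cmod (1 - of_real 1 * w x)) - ln 1 / 2"
      by (intro tendsto_intros r_lim) auto
    then show ?thesis
      using False by (simp add: f_def)
  qed (simp add: f_def)
  have "(\<lambda>k. - ln (r k) / 2) \<longlonglongrightarrow> - ln 1 / 2"
    by (intro tendsto_intros r_lim) auto
  then have int_lim: "(\<lambda>k. integral {0..1} (f k)) \<longlonglongrightarrow> 0"
    by (simp add: integral_unique[OF int_f])
  have "(\<lambda>x. ln (cmod (1 - w x))) integrable_on {0..1} \<and>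
      (\<lambda>k. integral {0..1} (f k)) \<longlonglongrightarrow> integral {0..1} (\<lambda>x. ln (cmod (1 - w x)))"
    by (rule monotone_convergence_decreasing[OF _ decreasing lim convergent_imp_bounded[OF int_lim]])
      (use int_f in blast)
  then show ?thesis
    using LIMSEQ_unique[OF int_lim] unfolding w_def by (metis has_integral_integrable_integral)
qed

lemma jensen_linear:
  "((\<lambda>x. ln (cmod (cis (2 * pi * x) - a))) has_integral ln (max 1 (cmod a))) {0..1}"
proof (cases "cmod a \<le> 1")
  case True
  have "cmod (cis t - a) = cmod (1 - cnj a * cis t)" for t
  proof -
    have "cis t - a = cis t * cnj (1 - cnj a * cis t)"
      by (simp add: algebra_simps cis_cnj cis_mult)
    then show ?thesis
      by (simp only: norm_mult norm_cis complex_mod_cnj mult_1)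
  qed
  then show ?thesis
    using True has_integral_ln_cmod_one_minus_interior[of "cnj a"]
      has_integral_ln_cmod_one_minus_boundary[of "cnj a"] by (cases "cmod a = 1") auto
next
  case False
  then have outside: "a \<noteq> 0" "cmod (1 / a) < 1"
    by (auto simp: norm_divide divide_less_eq)
  have "ln (cmod (cis t - a)) = ln (cmod a) + ln (cmod (1 - 1 / a * cis t))" for t
  proof -
    have "cis t - a = - a * (1 - 1 / a * cis t)"
      using outside(1) by (simp add: algebra_simps)
    moreover have "1 - 1 / a * cis t \<noteq> 0"
      using False outside(1) by (auto simp: field_simps)
    ultimately show ?thesis
      using outside(1) by (simp only: norm_mult norm_minus_cancel) (simp add: ln_mult_pos)
  qed
  then show ?thesis
    using has_integral_add[OF has_integral_const_real[of "ln (cmod a)" 0 1]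
        has_integral_ln_cmod_one_minus_interior[OF outside(2)]] False by (simp add: max_def)
qed

theorem jensen_poly:
  assumes "p \<noteq> 0"
  shows "((\<lambda>x. ln (cmod (poly p (cis (2 * pi * x))))) has_integral ln (mahler_measure p)) {0..1}"
proof -
  obtain r where factors: "\<And>s. poly p s = lead_coeff p * (\<Prod>i<degree p. s - r i)"
    and mahler: "mahler_measure p = cmod (lead_coeff p) * (\<Prod>i<degree p. max 1 (cmod (r i)))"
    using complex_poly_linear_factors[of p] by blast
  have ln_poly: "ln (cmod (poly p s)) = ln (cmod (lead_coeff p)) + (\<Sum>i<degree p. ln (cmod (s - r i)))"
    if "poly p s \<noteq> 0" for s
  proof -
    have pos: "0 < cmod (s - r i)" if "i \<in> {..<degree p}" for i
      using that \<open>poly p s \<noteq> 0\<close> by (auto simp: factors)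
    then have "0 < (\<Prod>i<degree p. cmod (s - r i))"
      by (rule prod_pos)
    then have "ln (cmod (poly p s)) = ln (cmod (lead_coeff p)) + ln (\<Prod>i<degree p. cmod (s - r i))"
      unfolding factors[of s] using assms
      by (simp add: norm_mult ln_mult_pos flip: prod_norm)
    also have "ln (\<Prod>i<degree p. cmod (s - r i)) = (\<Sum>i<degree p. ln (cmod (s - r i)))"
      using pos by (intro ln_prod) auto
    finally show ?thesis .
  qed
  have "ln (mahler_measure p) = ln (cmod (lead_coeff p)) + (\<Sum>i<degree p. ln (max 1 (cmod (r i))))"
    unfolding mahler using assms by (simp add: ln_mult_pos ln_prod prod_pos less_max_iff_disj)
  moreover have "((\<lambda>x. ln (cmod (lead_coeff p)) + (\<Sum>i<degree p. ln (cmod (cis (2 * pi * x) - r i))))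
      has_integral ln (cmod (lead_coeff p)) + (\<Sum>i<degree p. ln (max 1 (cmod (r i))))) {0..1}"
    using has_integral_const_real[of "ln (cmod (lead_coeff p))" 0 1]
    by (intro has_integral_add has_integral_sum jensen_linear) auto
  ultimately have "((\<lambda>x. ln (cmod (lead_coeff p)) + (\<Sum>i<degree p. ln (cmod (cis (2 * pi * x) - r i))))
      has_integral ln (mahler_measure p)) {0..1}"
    by simp
  then show ?thesis
    by (rule has_integral_spike_finite[OF finite_circle_roots[OF assms] ln_poly, rotated]) simp
qed

section \<open>Growth of the Mahler measure of \<open>e a\<^sup>n + q b\<^sup>n\<close>\<close>

lemma prod_roots_unity_diff:
  fixes a b :: complex
  assumes "N > 0"
  shows "(\<Prod>u | u ^ N = 1. a - u * b) = a ^ N - b ^ N"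
proof (cases "b = 0")
  case True
  then show ?thesis
    using assms by (simp add: card_roots_unity_eq)
next
  case False
  define p :: "complex poly" where "p = monom 1 N - 1"
  have poly_p: "poly p u = u ^ N - 1" for u
    by (simp add: p_def poly_monom)
  have "rsquarefree p"
    using assms unfolding rsquarefree_roots
    by (auto simp: p_def poly_monom pderiv_diff pderiv_monom power_0_left)
  moreover have "lead_coeff p = 1"
    using assms degree_add_eq_left[of "- 1" "monom 1 N :: complex poly"]
    by (simp add: p_def degree_monom_eq)
  ultimately have "(\<Prod>u | u ^ N = 1. [:- u, 1:]) = p"
    using complex_poly_decompose_rsquarefree[of p] by (simp add: poly_p)
  from arg_cong[OF this, of "\<lambda>p. poly p (a / b)"]
  have "(\<Prod>u | u ^ N = 1. a / b - u) = (a / b) ^ N - 1"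
    by (simp add: poly_prod poly_p)
  moreover have "(\<Prod>u | u ^ N = 1. a - u * b) = b ^ N * (\<Prod>u | u ^ N = 1. a / b - u)"
  proof -
    have "(\<Prod>u | u ^ N = 1. a - u * b) = (\<Prod>u | u ^ N = 1. b * (a / b - u))"
      using False by (intro prod.cong) (auto simp: field_simps)
    then show ?thesis
      using assms by (simp add: prod.distrib card_roots_unity_eq)
  qed
  ultimately show ?thesis
    using False by (simp add: field_simps)
qed

definition rotation_prod :: "(complex \<Rightarrow> real) \<Rightarrow> nat \<Rightarrow> complex \<Rightarrow> real" where
  "rotation_prod f N s = (\<Prod>u | u ^ N = 1. f (u * s))"

definition max_cmod :: "complex poly \<Rightarrow> complex poly \<Rightarrow> complex \<Rightarrow> real" where
  "max_cmod a b z = max (cmod (poly a z)) (cmod (poly b z))"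

lemma rotation_prod_poly_eq:
  assumes "N > 0" and factors: "\<And>s. poly p s = c * (\<Prod>i\<in>I. s - r i)"
  shows "rotation_prod (\<lambda>z. cmod (poly p z)) N s = cmod c ^ N * (\<Prod>i\<in>I. cmod (r i ^ N - s ^ N))"
proof -
  have "rotation_prod (\<lambda>z. cmod (poly p z)) N s =
      cmod c ^ N * (\<Prod>u | u ^ N = 1. \<Prod>i\<in>I. cmod (r i - u * s))"
    using assms(1) by (simp add: rotation_prod_def factors norm_mult prod.distrib card_roots_unity_eq
        norm_minus_commute flip: prod_norm)
  also have "\<dots> = cmod c ^ N * (\<Prod>i\<in>I. cmod (\<Prod>u | u ^ N = 1. r i - u * s))"
    by (simp add: prod_norm[symmetric] prod.swap[of _ I])
  finally show ?thesis
    by (simp add: prod_roots_unity_diff[OF assms(1)])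
qed

lemma rotation_prod_poly_le_mahler_measure:
  assumes "N > 0" "1 \<le> cmod s"
  shows "rotation_prod (\<lambda>z. cmod (poly p z)) N s \<le> (cmod s ^ N + 1) ^ degree p * mahler_measure p ^ N"
proof -
  obtain r where factors: "\<And>s. poly p s = lead_coeff p * (\<Prod>i<degree p. s - r i)"
    and mahler: "mahler_measure p = cmod (lead_coeff p) * (\<Prod>i<degree p. max 1 (cmod (r i)))"
    using complex_poly_linear_factors[of p] by blast
  define x where "x = cmod s ^ N"
  have x: "1 \<le> x"
    using assms by (simp add: x_def)
  have "cmod (z ^ N - s ^ N) \<le> (x + 1) * max 1 (cmod z) ^ N" for z
  proof -
    have max_ge: "1 \<le> max 1 (cmod z) ^ N" "cmod z ^ N \<le> max 1 (cmod z) ^ N"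
      by (auto intro: power_mono)
    have "cmod (z ^ N - s ^ N) \<le> cmod z ^ N + x"
      using norm_triangle_ineq4[of "z ^ N" "s ^ N"] by (simp add: norm_power x_def)
    also have "\<dots> \<le> max 1 (cmod z) ^ N + x * max 1 (cmod z) ^ N"
      using max_ge x by (intro add_mono) auto
    finally show ?thesis
      by (simp add: algebra_simps)
  qed
  then have "(\<Prod>i<degree p. cmod (r i ^ N - s ^ N)) \<le> (\<Prod>i<degree p. (x + 1) * max 1 (cmod (r i)) ^ N)"
    by (intro prod_mono) auto
  then have "cmod (lead_coeff p) ^ N * (\<Prod>i<degree p. cmod (r i ^ N - s ^ N)) \<le>
      cmod (lead_coeff p) ^ N * (\<Prod>i<degree p. (x + 1) * max 1 (cmod (r i)) ^ N)"
    by (rule mult_left_mono) simp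
  then show ?thesis
    unfolding rotation_prod_poly_eq[OF assms(1) factors] mahler x_def
    by (simp add: prod.distrib power_mult_distrib prod_power_distrib mult_ac)
qed

lemma rotation_prod_poly_ge:
  assumes "N > 0" "1 \<le> cmod s" and roots: "\<And>z. poly p z = 0 \<Longrightarrow> cmod z \<le> 1"
  shows "cmod (lead_coeff p) ^ N * (cmod s ^ N - 1) ^ degree p \<le> rotation_prod (\<lambda>z. cmod (poly p z)) N s"
proof -
  obtain r where factors: "\<And>s. poly p s = lead_coeff p * (\<Prod>i<degree p. s - r i)"
    using complex_poly_linear_factors[of p] by blast
  have "cmod s ^ N - 1 \<le> cmod (r i ^ N - s ^ N)" if "i < degree p" for i
  proof -
    have "poly p (r i) = 0"
      using that by (auto simp: factors)
    then have "cmod (r i) ^ N \<le> 1"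
      using roots by (intro power_le_one) auto
    then show ?thesis
      using norm_triangle_ineq3[of "r i ^ N" "s ^ N"] by (simp add: norm_power)
  qed
  then have "(\<Prod>i<degree p. cmod s ^ N - 1) \<le> (\<Prod>i<degree p. cmod (r i ^ N - s ^ N))"
    using assms(2) by (intro prod_mono) auto
  then show ?thesis
    unfolding rotation_prod_poly_eq[OF assms(1) factors] by (simp add: mult_left_mono)
qed

lemma interior_cmod_poly_eq_cmod_poly:
  fixes a b :: "complex poly"
  assumes "b \<noteq> 0" and indep: "\<And>k. a \<noteq> smult k b"
  shows "interior {s. cmod (poly a s) = cmod (poly b s)} = {}"
proof (rule ccontr)
  define S where "S = interior {s. cmod (poly a s) = cmod (poly b s)} - {s. poly b s = 0}"
  define f where "f s = poly a s / poly b s" for s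
  assume "interior {s. cmod (poly a s) = cmod (poly b s)} \<noteq> {}"
  then have "infinite (interior {s. cmod (poly a s) = cmod (poly b s)})"
    using finite_imp_not_open by blast
  then have "S \<noteq> {}"
    unfolding S_def using poly_roots_finite[OF assms(1)] by (metis Diff_eq_empty_iff finite_subset)
  moreover have "open S"
    unfolding S_def using poly_roots_finite[OF assms(1)]
    by (intro open_Diff open_interior finite_imp_closed)
  ultimately obtain z e where ball: "e > 0" "ball z e \<subseteq> S"
    by (metis all_not_in_conv open_contains_ball)
  have b_nonzero: "poly b s \<noteq> 0" if "s \<in> ball z e" for s
    using that ball(2) by (auto simp: S_def)
  have "f ` ball z e \<subseteq> sphere 0 1"
    using ball(2) interior_subset by (force simp: f_def S_def norm_divide)
  then have "\<not> open (f ` ball z e)"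
    using ball(1) open_not_negligible[of "f ` ball z e"]
      negligible_subset[OF negligible_sphere, of "f ` ball z e" 0 1] by auto
  moreover have "f holomorphic_on ball z e"
    unfolding f_def using b_nonzero by (intro holomorphic_intros) auto
  ultimately have "f constant_on ball z e"
    using open_mapping_thm[of f "ball z e" "ball z e"] by auto
  then obtain k where "\<And>s. s \<in> ball z e \<Longrightarrow> f s = k"
    by (auto simp: constant_on_def)
  then have "ball z e \<subseteq> {s. poly (a - smult k b) s = 0}"
    using b_nonzero by (auto simp: f_def field_simps)
  moreover have "infinite (ball z e)"
    using ball(1) finite_imp_not_open[of "ball z e"] by auto
  ultimately have "a - smult k b = 0"
    using poly_roots_finite finite_subset by blast
  then show False
    using indep by simp
qed

lemma interior_vimage_mult_eq_empty:
  fixes B :: "complex set"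
  assumes "u \<noteq> 0" "interior B = {}"
  shows "interior ((*) u -` B) = {}"
proof -
  let ?O = "(\<lambda>t. t / u) -` interior ((*) u -` B)"
  have "open ?O"
    using assms(1) by (intro open_vimage open_interior continuous_intros) auto
  moreover have "?O \<subseteq> B"
    using interior_subset[of "(*) u -` B"] assms(1) by force
  ultimately have "?O = {}"
    using assms(2) interior_maximal by blast
  moreover have "u * s \<in> ?O \<longleftrightarrow> s \<in> interior ((*) u -` B)" for s
    using assms(1) by simp
  ultimately show ?thesis
    by blast
qed

lemma exists_rotations_avoiding_closed:
  fixes B V :: "complex set"
  assumes "N > 0" "closed B" "interior B = {}" "open V" "V \<noteq> {}"
  obtains s where "s \<in> V" "\<And>u. u ^ N = 1 \<Longrightarrow> u * s \<notin> B"
proof -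
  let ?G = "(\<lambda>u. - ((*) u -` B)) ` {u. u ^ N = 1}"
  have "openin (top_of_set UNIV) T \<and> UNIV \<subseteq> closure T" if "T \<in> ?G" for T
  proof -
    from that obtain u where u: "u ^ N = 1" "T = - ((*) u -` B)"
      by (elim imageE CollectE)
    have "u \<noteq> 0"
      using u(1) assms(1) by (auto simp: power_0_left)
    have "open T"
      unfolding u(2) by (intro open_Compl closed_vimage assms continuous_intros)
    moreover have "interior ((*) u -` B) = {}"
      by (rule interior_vimage_mult_eq_empty[OF \<open>u \<noteq> 0\<close> assms(3)])
    ultimately show ?thesis
      by (simp add: u(2) closure_complement)
  qed
  moreover have "countable ?G"
    using assms(1) by (intro countable_finite finite_imageI finite_roots_unity) simp
  ultimately have "UNIV \<subseteq> closure (\<Inter>?G)"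
    by (intro Baire) auto
  then have "V \<inter> \<Inter>?G \<noteq> {}"
    using assms(4,5) open_Int_closure_eq_empty by blast
  then show ?thesis
    using that by blast
qed

lemma exists_outside_disc_near_circle:
  fixes \<zeta> :: complex
  assumes "open V" "\<zeta> \<in> V" "cmod \<zeta> = 1"
  obtains s where "s \<in> V" "1 < cmod s"
proof -
  have "((\<lambda>t. of_real t * \<zeta>) \<longlongrightarrow> of_real 1 * \<zeta>) (at_right 1)"
    by (intro tendsto_intros)
  then have "eventually (\<lambda>t. of_real t * \<zeta> \<in> V) (at_right 1)"
    using assms(1,2) by (intro topological_tendstoD) auto
  moreover have "eventually (\<lambda>t. 1 < t) (at_right (1::real))"
    by (rule eventually_at_right_less)
  ultimately have "eventually (\<lambda>t. of_real t * \<zeta> \<in> V \<and> 1 < cmod (of_real t * \<zeta>)) (at_right 1)"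
    by eventually_elim (use assms(3) in \<open>simp add: norm_mult\<close>)
  then show ?thesis
    using that eventually_happens'[of "at_right (1::real)"] by fastforce
qed

lemma exists_generic_rotations:
  fixes a b h :: "complex poly"
  assumes "b \<noteq> 0" "\<And>k. a \<noteq> smult k b" "h \<noteq> 0" and "N > 0" "open V" "V \<noteq> {}"
  obtains s where "s \<in> V" "\<And>u. u ^ N = 1 \<Longrightarrow> cmod (poly a (u * s)) \<noteq> cmod (poly b (u * s))"
    "\<And>u. u ^ N = 1 \<Longrightarrow> poly h (u * s) \<noteq> 0"
proof -
  define B where "B = {s. cmod (poly a s) = cmod (poly b s)} \<union> {s. poly h s = 0}"
  have "interior {s. cmod (poly a s) = cmod (poly b s)} = {}"
    by (rule interior_cmod_poly_eq_cmod_poly[OF assms(1,2)])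
  moreover have "closed {s. cmod (poly a s) = cmod (poly b s)}"
    by (intro closed_Collect_eq continuous_intros)
  moreover have "finite {s. poly h s = 0}"
    by (rule poly_roots_finite[OF assms(3)])
  ultimately have "closed B" "interior B = {}"
    unfolding B_def
    by (auto simp: interior_closed_Un_empty_interior empty_interior_finite finite_imp_closed)
  then obtain s where "s \<in> V" "\<And>u. u ^ N = 1 \<Longrightarrow> u * s \<notin> B"
    using exists_rotations_avoiding_closed[OF assms(4) _ _ assms(5,6)] by blast
  then show ?thesis
    using that by (auto simp: B_def)
qed

lemma eventually_succ_power_less_two_mult_pred_power:
  "eventually (\<lambda>x::real. (x + 1) ^ m < 2 * (x - 1) ^ m) at_top"
proof -
  have "((\<lambda>x::real. ((x + 1) / (x - 1)) ^ m) \<longlongrightarrow> 1 ^ m) at_top"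
    by (intro tendsto_power) real_asymp
  then have "eventually (\<lambda>x::real. ((x + 1) / (x - 1)) ^ m < 2) at_top"
    by (rule order_tendstoD) simp
  then show ?thesis
    using eventually_gt_at_top[of 1]
    by eventually_elim (simp add: power_divide field_simps)
qed

lemma mult_prod_le_prod_max:
  fixes f g :: "'a \<Rightarrow> real"
  assumes "finite U" "v \<in> U" "\<And>u. u \<in> U \<Longrightarrow> 0 \<le> g u" "k * g v \<le> f v"
  shows "k * (\<Prod>u\<in>U. g u) \<le> (\<Prod>u\<in>U. max (f u) (g u))"
proof -
  have "k * (\<Prod>u\<in>U. g u) = k * g v * (\<Prod>u\<in>U - {v}. g u)"
    using assms(1,2) by (simp add: prod.remove)
  also have "\<dots> \<le> max (f v) (g v) * (\<Prod>u\<in>U - {v}. max (f u) (g u))"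
    using assms by (intro mult_mono prod_mono prod_nonneg) (auto simp: le_max_iff_disj)
  also have "\<dots> = (\<Prod>u\<in>U. max (f u) (g u))"
    using assms(1,2) by (simp add: prod.remove)
  finally show ?thesis .
qed

lemma power_less_rotation_prod_max:
  assumes "N > 0" "1 < cmod s" and lead: "1 \<le> cmod (lead_coeff b)"
    and roots: "\<And>z. poly b z = 0 \<Longrightarrow> cmod z \<le> 1" and "2 * cmod (poly b s) \<le> cmod (poly a s)"
    and large: "(cmod s ^ N + 1) ^ degree b < 2 * (cmod s ^ N - 1) ^ degree b"
  shows "(cmod s ^ N + 1) ^ degree b < rotation_prod (max_cmod a b) N s"
proof -
  note large
  also have "(cmod s ^ N - 1) ^ degree b \<le> cmod (lead_coeff b) ^ N * (cmod s ^ N - 1) ^ degree b"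
    using mult_right_mono[OF one_le_power[OF lead, of N], of "(cmod s ^ N - 1) ^ degree b"] assms(2)
    by simp
  also have "\<dots> \<le> rotation_prod (\<lambda>z. cmod (poly b z)) N s"
    using assms(1,2) roots by (intro rotation_prod_poly_ge) auto
  also have "2 * \<dots> \<le> rotation_prod (max_cmod a b) N s"
    unfolding rotation_prod_def max_cmod_def using assms(1,5)
    by (intro mult_prod_le_prod_max[of _ 1] finite_roots_unity) auto
  finally show ?thesis
    by simp
qed

lemma exists_dominant_rotations:
  fixes a b h :: "complex poly"
  assumes lead: "1 \<le> cmod (lead_coeff b)" and roots: "\<And>z. poly b z = 0 \<Longrightarrow> cmod z \<le> 1"
    and \<zeta>: "poly b \<zeta> = 0" "cmod \<zeta> = 1" "poly a \<zeta> \<noteq> 0" and h_nonzero: "h \<noteq> 0"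
  obtains N s where "N > 0" "1 < cmod s"
    "(cmod s ^ N + 1) ^ degree b < rotation_prod (max_cmod a b) N s"
    "\<And>u. u ^ N = 1 \<Longrightarrow> cmod (poly a (u * s)) \<noteq> cmod (poly b (u * s))"
    "\<And>u. u ^ N = 1 \<Longrightarrow> poly h (u * s) \<noteq> 0"
proof -
  define V where "V = {s. 2 * cmod (poly b s) < cmod (poly a s)}"
  have "open V"
    unfolding V_def by (intro open_Collect_less continuous_intros)
  obtain s1 where s1: "s1 \<in> V" "1 < cmod s1"
    using exists_outside_disc_near_circle[OF \<open>open V\<close>, of \<zeta>] \<zeta> by (auto simp: V_def)
  obtain R where R: "1 < R" "R < cmod s1"
    using dense[OF s1(2)] by blast
  obtain X where large: "\<And>x::real. X \<le> x \<Longrightarrow> (x + 1) ^ degree b < 2 * (x - 1) ^ degree b"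
    using eventually_succ_power_less_two_mult_pred_power unfolding eventually_at_top_linorder by blast
  obtain N where N: "X < R ^ N" "N > 0"
    using real_arch_pow[OF R(1), of "max 1 X"] by (metis gr0I max_less_iff_conj less_irrefl power_0)
  have "b \<noteq> 0" "\<And>k. a \<noteq> smult k b"
    using lead \<zeta> by auto
  moreover have "open (V \<inter> {s. R < cmod s})"
    by (intro open_Int \<open>open V\<close> open_Collect_less continuous_intros)
  moreover have "V \<inter> {s. R < cmod s} \<noteq> {}"
    using s1(1) R(2) by auto
  ultimately obtain s where s: "s \<in> V \<inter> {s. R < cmod s}"
    and generic: "\<And>u. u ^ N = 1 \<Longrightarrow> cmod (poly a (u * s)) \<noteq> cmod (poly b (u * s))"
      "\<And>u. u ^ N = 1 \<Longrightarrow> poly h (u * s) \<noteq> 0"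
    using exists_generic_rotations[of b a h N] h_nonzero N(2) by blast
  have "1 < cmod s" "R ^ N \<le> cmod s ^ N"
    using s R(1) by (auto intro: power_mono)
  then have "(cmod s ^ N + 1) ^ degree b < 2 * (cmod s ^ N - 1) ^ degree b"
    using N(1) by (intro large) simp
  then have "(cmod s ^ N + 1) ^ degree b < rotation_prod (max_cmod a b) N s"
    using \<open>1 < cmod s\<close> s N(2) lead roots by (intro power_less_rotation_prod_max) (auto simp: V_def)
  then show ?thesis
    using that N(2) \<open>1 < cmod s\<close> generic by blast
qed

lemma power_sum_lower_bound:
  fixes a b e q :: complex
  assumes "cmod a \<noteq> cmod b" "e \<noteq> 0" "q \<noteq> 0"
  obtains \<kappa> where "\<kappa> > 0"
    "eventually (\<lambda>n. \<kappa> * max (cmod a) (cmod b) ^ n \<le> cmod (e * a ^ n + q * b ^ n)) sequentially"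
proof -
  have dominant: "eventually (\<lambda>n. cmod e / 2 * cmod a ^ n \<le> cmod (e * a ^ n + q * b ^ n)) sequentially"
    if lt: "cmod b < cmod a" and "e \<noteq> 0" for a b e q :: complex
  proof -
    have "0 < cmod a"
      using lt norm_ge_zero[of b] by linarith
    then have "(\<lambda>n. cmod q * (cmod b / cmod a) ^ n) \<longlonglongrightarrow> cmod q * 0"
      using lt by (intro tendsto_intros LIMSEQ_power_zero) auto
    then have "eventually (\<lambda>n. cmod q * (cmod b / cmod a) ^ n < cmod e / 2) sequentially"
      using \<open>e \<noteq> 0\<close> by (intro order_tendstoD) auto
    then show ?thesis
    proof eventually_elim
      case (elim n)
      then have "cmod q * cmod b ^ n \<le> cmod e / 2 * cmod a ^ n"
        using \<open>0 < cmod a\<close> by (simp add: power_divide field_simps)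
      then show ?case
        using norm_diff_ineq[of "e * a ^ n" "q * b ^ n"] by (simp add: norm_mult norm_power)
    qed
  qed
  show ?thesis
  proof (cases "cmod b < cmod a")
    case True
    then show ?thesis
      using that[of "cmod e / 2"] dominant[OF True assms(2)] assms(2) by simp
  next
    case False
    then show ?thesis
      using that[of "cmod q / 2"] dominant[of a b q e] assms by (simp add: add.commute)
  qed
qed

lemma prod_power_sum_lower_bound:
  fixes a b e q :: "'i \<Rightarrow> complex"
  assumes "finite U" and "\<And>u. u \<in> U \<Longrightarrow> cmod (a u) \<noteq> cmod (b u)"
    and "\<And>u. u \<in> U \<Longrightarrow> e u \<noteq> 0" "\<And>u. u \<in> U \<Longrightarrow> q u \<noteq> 0"
  obtains K where "K > 0" "eventually (\<lambda>n. K * (\<Prod>u\<in>U. max (cmod (a u)) (cmod (b u))) ^ n \<le>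
      (\<Prod>u\<in>U. cmod (e u * a u ^ n + q u * b u ^ n))) sequentially"
proof -
  have "\<exists>\<kappa>>0. eventually (\<lambda>n. \<kappa> * max (cmod (a u)) (cmod (b u)) ^ n \<le>
      cmod (e u * a u ^ n + q u * b u ^ n)) sequentially" if "u \<in> U" for u
    by (rule power_sum_lower_bound[OF assms(2-4)[OF that]]) blast
  then have "\<forall>u\<in>U. \<exists>\<kappa>>0. eventually (\<lambda>n. \<kappa> * max (cmod (a u)) (cmod (b u)) ^ n \<le>
      cmod (e u * a u ^ n + q u * b u ^ n)) sequentially"
    by blast
  from bchoice[OF this] obtain \<kappa> where pos: "\<And>u. u \<in> U \<Longrightarrow> \<kappa> u > 0"
    and bound: "\<And>u. u \<in> U \<Longrightarrow> eventually (\<lambda>n. \<kappa> u * max (cmod (a u)) (cmod (b u)) ^ n \<le>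
      cmod (e u * a u ^ n + q u * b u ^ n)) sequentially"
    by blast
  have "eventually (\<lambda>n. \<forall>u\<in>U. \<kappa> u * max (cmod (a u)) (cmod (b u)) ^ n \<le>
      cmod (e u * a u ^ n + q u * b u ^ n)) sequentially"
    using assms(1) bound by (intro eventually_ball_finite) auto
  then have "eventually (\<lambda>n. (\<Prod>u\<in>U. \<kappa> u) * (\<Prod>u\<in>U. max (cmod (a u)) (cmod (b u))) ^ n \<le>
      (\<Prod>u\<in>U. cmod (e u * a u ^ n + q u * b u ^ n))) sequentially"
  proof eventually_elim
    case (elim n)
    have "(\<Prod>u\<in>U. \<kappa> u) * (\<Prod>u\<in>U. max (cmod (a u)) (cmod (b u))) ^ n =
        (\<Prod>u\<in>U. \<kappa> u * max (cmod (a u)) (cmod (b u)) ^ n)"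
      by (simp add: prod.distrib prod_power_distrib)
    also have "\<dots> \<le> (\<Prod>u\<in>U. cmod (e u * a u ^ n + q u * b u ^ n))"
      using elim pos by (intro prod_mono) (auto simp: less_imp_le le_max_iff_disj)
    finally show ?case .
  qed
  moreover have "(\<Prod>u\<in>U. \<kappa> u) > 0"
    using pos by (rule prod_pos)
  ultimately show ?thesis
    using that by blast
qed

lemma degree_power_sum_le:
  fixes a b e q :: "'a :: comm_semiring_1 poly"
  assumes "degree a \<le> m" "degree b \<le> m"
  shows "degree (e * a ^ n + q * b ^ n) \<le> max (degree e) (degree q) + m * n"
proof (rule degree_add_le)
  have deg: "degree (f * g ^ n) \<le> degree f + m * n" if "degree g \<le> m" for f g :: "'a poly"
    using degree_mult_le[of f "g ^ n"] degree_power_le[of g n] mult_le_mono1[OF that, of n] by linarith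
  show "degree (e * a ^ n) \<le> max (degree e) (degree q) + m * n"
    "degree (q * b ^ n) \<le> max (degree e) (degree q) + m * n"
    using deg[OF assms(1), of e] deg[OF assms(2), of q] by linarith+
qed

lemma rotation_prod_power_sum_le_mahler_measure:
  assumes "N > 0" "1 \<le> cmod s" "degree a \<le> degree b"
  shows "rotation_prod (\<lambda>z. cmod (poly (e * a ^ n + q * b ^ n) z)) N s \<le>
    (cmod s ^ N + 1) ^ (max (degree e) (degree q) + degree b * n) *
    mahler_measure (e * a ^ n + q * b ^ n) ^ N"
    (is "_ \<le> ?x ^ ?d * mahler_measure ?p ^ N")
proof -
  have "rotation_prod (\<lambda>z. cmod (poly ?p z)) N s \<le> ?x ^ degree ?p * mahler_measure ?p ^ N"
    by (rule rotation_prod_poly_le_mahler_measure[OF assms(1,2)])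
  also have "\<dots> \<le> ?x ^ ?d * mahler_measure ?p ^ N"
    using degree_power_sum_le[OF assms(3) order_refl] mahler_measure_nonneg
    by (intro mult_right_mono power_increasing) auto
  finally show ?thesis .
qed

lemma rotation_prod_power_sum_lower_bound:
  assumes "N > 0" and "\<And>u. u ^ N = 1 \<Longrightarrow> cmod (poly a (u * s)) \<noteq> cmod (poly b (u * s))"
    and "\<And>u. u ^ N = 1 \<Longrightarrow> poly (e * q) (u * s) \<noteq> 0"
  obtains K where "K > 0" "eventually (\<lambda>n. K * rotation_prod (max_cmod a b) N s ^ n \<le>
      rotation_prod (\<lambda>z. cmod (poly (e * a ^ n + q * b ^ n) z)) N s) sequentially"
proof -
  have "finite {u::complex. u ^ N = 1}"
    using assms(1) by (intro finite_roots_unity) simp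
  then show ?thesis
    using that prod_power_sum_lower_bound[of "{u. u ^ N = 1}" "\<lambda>u. poly a (u * s)" "\<lambda>u. poly b (u * s)"
        "\<lambda>u. poly e (u * s)" "\<lambda>u. poly q (u * s)"] assms(2,3)
    by (auto simp: rotation_prod_def max_cmod_def)
qed

lemma mahler_measure_power_sum_growth:
  fixes a b e q :: "complex poly"
  assumes deg: "degree a \<le> degree b" and lead: "1 \<le> cmod (lead_coeff b)"
    and roots: "\<And>z. poly b z = 0 \<Longrightarrow> cmod z \<le> 1"
    and \<zeta>: "poly b \<zeta> = 0" "cmod \<zeta> = 1" "poly a \<zeta> \<noteq> 0" and nonzero: "e \<noteq> 0" "q \<noteq> 0"
  obtains N C \<rho> where "N > 0" "C > 0" "\<rho> > 1"
    "eventually (\<lambda>n. C * \<rho> ^ n \<le> mahler_measure (e * a ^ n + q * b ^ n) ^ N) sequentially"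
proof -
  have "e * q \<noteq> 0"
    using nonzero by simp
  from exists_dominant_rotations[OF lead roots \<zeta> this]
  obtain N s where N: "N > 0" and s: "1 < cmod s"
    and dominant: "(cmod s ^ N + 1) ^ degree b < rotation_prod (max_cmod a b) N s"
    and generic: "\<And>u. u ^ N = 1 \<Longrightarrow> cmod (poly a (u * s)) \<noteq> cmod (poly b (u * s))"
      "\<And>u. u ^ N = 1 \<Longrightarrow> poly (e * q) (u * s) \<noteq> 0"
    by blast
  define x m d where "x = cmod s ^ N + 1" and "m = rotation_prod (max_cmod a b) N s"
    and "d = max (degree e) (degree q)"
  have "0 < cmod s"
    using s by linarith
  then have x_gt_1: "x > 1"
    by (simp add: x_def)
  obtain K where "K > 0" and lower_bound: "eventually (\<lambda>n. K * m ^ n \<le>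
      rotation_prod (\<lambda>z. cmod (poly (e * a ^ n + q * b ^ n) z)) N s) sequentially"
    unfolding m_def by (rule rotation_prod_power_sum_lower_bound[OF N generic])
  from lower_bound have "eventually (\<lambda>n. K / x ^ d * (m / x ^ degree b) ^ n \<le>
      mahler_measure (e * a ^ n + q * b ^ n) ^ N) sequentially"
  proof eventually_elim
    case (elim n)
    have "K * m ^ n \<le> rotation_prod (\<lambda>z. cmod (poly (e * a ^ n + q * b ^ n) z)) N s"
      by (rule elim)
    also have "\<dots> \<le> x ^ (d + degree b * n) * mahler_measure (e * a ^ n + q * b ^ n) ^ N"
      unfolding x_def d_def using s by (intro rotation_prod_power_sum_le_mahler_measure N deg) simp
    finally show ?case
      using x_gt_1 by (simp add: power_divide power_add field_simps flip: power_mult)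
  qed
  moreover have "m / x ^ degree b > 1"
    using dominant x_gt_1 by (simp add: m_def x_def)
  moreover have "K / x ^ d > 0"
    using \<open>K > 0\<close> x_gt_1 by simp
  ultimately show ?thesis
    using that N by blast
qed

theorem mahler_measure_power_sum_at_top:
  fixes a b e q :: "complex poly"
  assumes "degree a \<le> degree b" "1 \<le> cmod (lead_coeff b)" "\<And>z. poly b z = 0 \<Longrightarrow> cmod z \<le> 1"
    and "poly b \<zeta> = 0" "cmod \<zeta> = 1" "poly a \<zeta> \<noteq> 0" "e \<noteq> 0" "q \<noteq> 0"
  shows "filterlim (\<lambda>n. mahler_measure (e * a ^ n + q * b ^ n)) at_top sequentially"
    (is "filterlim ?M _ _")
proof -
  obtain N C \<rho> where N: "N > 0" and "C > 0" "\<rho> > 1"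
    and growth: "eventually (\<lambda>n. C * \<rho> ^ n \<le> ?M n ^ N) sequentially"
    by (rule mahler_measure_power_sum_growth[OF assms])
  then have "filterlim (\<lambda>n. C * \<rho> ^ n) at_top sequentially"
    by real_asymp
  then have power: "filterlim (\<lambda>n. ?M n ^ N) at_top sequentially"
    by (rule filterlim_at_top_mono[OF _ growth])
  have "eventually (\<lambda>n. Y \<le> ?M n) sequentially" for Y
    using power[unfolded filterlim_at_top, rule_format, of "max 0 Y ^ N"]
  proof eventually_elim
    case (elim n)
    then show ?case
      using N mahler_measure_nonneg by (simp add: power_mono_iff)
  qed
  then show ?thesis
    by (simp add: filterlim_at_top)
qed

section \<open>The Jones polynomial\<close>

text \<open>The closed form of the bracket is a trace: with \<open>s = A\<^sup>4\<close> and \<open>d = - A\<^sup>2 - A\<^sup>-\<^sup>2\<close>, the values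
  \<open>s (d\<^sup>2 - 1 + (- s)\<^sup>c)\<close> and \<open>s ((- s)\<^sup>c - 1)\<close> of the following polynomials are, up to scaling, the
  eigenvalues of a twist region on the trivial and on the adjoint summand, and
  \<open>d\<^sup>2 - 1 = (1 + s + s\<^sup>2) / s\<close> is the dimension of the latter.\<close>

definition trivial_eigen_poly :: "nat \<Rightarrow> complex poly" where
  "trivial_eigen_poly c = monom ((- 1) ^ c) (Suc c) + [:1, 1, 1:]"

definition adjoint_eigen_poly :: "nat \<Rightarrow> complex poly" where
  "adjoint_eigen_poly c = monom ((- 1) ^ c) (Suc c) + [:0, - 1:]"

definition pretzel_poly :: "nat \<Rightarrow> nat \<Rightarrow> complex poly" where
  "pretzel_poly n c = [:0, 1:] * trivial_eigen_poly c ^ n + [:1, 1, 1:] * adjoint_eigen_poly c ^ n"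

lemma poly_trivial_eigen_poly: "poly (trivial_eigen_poly c) s = s * (- s) ^ c + (1 + s + s\<^sup>2)"
  by (simp add: trivial_eigen_poly_def poly_monom power_minus[of s] power2_eq_square algebra_simps)

lemma poly_adjoint_eigen_poly: "poly (adjoint_eigen_poly c) s = s * ((- s) ^ c - 1)"
  by (simp add: adjoint_eigen_poly_def poly_monom power_minus[of s] algebra_simps)

lemma poly_pretzel_poly:
  "poly (pretzel_poly n c) s =
    s * (s * (- s) ^ c + (1 + s + s\<^sup>2)) ^ n + (1 + s + s\<^sup>2) * (s * ((- s) ^ c - 1)) ^ n"
  by (simp add: pretzel_poly_def poly_trivial_eigen_poly poly_adjoint_eigen_poly power2_eq_square
      algebra_simps)

lemma degree_trivial_eigen_poly:
  assumes "c > 0"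
  shows "degree (trivial_eigen_poly c) \<le> Suc c"
  unfolding trivial_eigen_poly_def using assms degree_monom_le[of "(- 1 :: complex) ^ c" "Suc c"]
  by (intro degree_add_le) auto

lemma degree_adjoint_eigen_poly:
  assumes "c > 0"
  shows "degree (adjoint_eigen_poly c) = Suc c"
  using assms degree_add_eq_left[of "[:0, - 1:]" "monom ((- 1) ^ c) (Suc c) :: complex poly"]
  by (simp add: adjoint_eigen_poly_def degree_monom_eq)

lemma cmod_lead_coeff_adjoint_eigen_poly:
  assumes "c > 0"
  shows "cmod (lead_coeff (adjoint_eigen_poly c)) = 1"
  using assms unfolding degree_adjoint_eigen_poly[OF assms]
  by (simp add: adjoint_eigen_poly_def coeff_pCons norm_power split: nat.split)

lemma adjoint_eigen_poly_root_in_disc: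
  assumes "c > 0" "poly (adjoint_eigen_poly c) z = 0"
  shows "cmod z \<le> 1"
proof (cases "z = 0")
  case False
  then have "(- z) ^ c = 1"
    using assms(2) by (simp add: poly_adjoint_eigen_poly)
  from power_eq_1_iff[OF this] show ?thesis
    using assms(1) by simp
qed simp

lemma adjoint_eigen_poly_circle_root:
  assumes "c \<ge> 2"
  obtains \<zeta> where "cmod \<zeta> = 1" "poly (adjoint_eigen_poly c) \<zeta> = 0" "poly (trivial_eigen_poly c) \<zeta> \<noteq> 0"
proof -
  have "card {u::complex. u ^ c = 1} = c"
    using assms by (intro card_roots_unity_eq) simp
  then have "{u::complex. u ^ c = 1} \<noteq> {1}"
    using assms by auto
  then obtain u :: complex where u: "u ^ c = 1" "u \<noteq> 1"
    by auto
  have "cmod u = 1"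
    using power_eq_1_iff[OF u(1)] assms by simp
  moreover have "poly (trivial_eigen_poly c) (- u) = (1 - u)\<^sup>2"
    using u(1) by (simp add: poly_trivial_eigen_poly power2_eq_square algebra_simps)
  ultimately show ?thesis
    using that[of "- u"] u by (simp add: poly_adjoint_eigen_poly)
qed

lemma pretzel_poly_nonzero:
  assumes "n > 0" "c \<ge> 2"
  shows "pretzel_poly n c \<noteq> 0"
proof -
  obtain \<zeta> where "cmod \<zeta> = 1" "poly (adjoint_eigen_poly c) \<zeta> = 0" "poly (trivial_eigen_poly c) \<zeta> \<noteq> 0"
    by (rule adjoint_eigen_poly_circle_root[OF assms(2)])
  then have "poly (pretzel_poly n c) \<zeta> \<noteq> 0"
    using assms(1) by (auto simp: pretzel_poly_def power_0_left)
  then show ?thesis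
    by auto
qed

lemma cmod_pretzel_bracket:
  assumes "n > 0" "c > 0" and A: "cmod A = 1" and s: "s = A ^ 4"
  shows "cmod (pretzel_bracket n c A) * cmod (s + 1) ^ Suc n = cmod (poly (pretzel_poly n c) s)"
proof -
  define d where "d = - (A\<^sup>2) - inverse (A\<^sup>2)"
  have "A \<noteq> 0"
    using A by auto
  then have d_mult: "d * A\<^sup>2 = - (s + 1)"
    by (simp add: d_def s field_simps power2_eq_square power4_eq_xxxx)
  have "d\<^sup>2 * s = (d * A\<^sup>2)\<^sup>2"
    by (simp add: s power_mult_distrib flip: power_mult)
  then have adjoint_dim: "s * (d\<^sup>2 - 1) = 1 + s + s\<^sup>2"
    unfolding d_mult by (simp add: power2_eq_square algebra_simps)
  have scale: "s * s ^ n * (X ^ n + q * Y ^ n) = s * (s * X) ^ n + s * q * (s * Y) ^ n"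
    for X Y q :: complex
    by (simp add: power_mult_distrib algebra_simps)
  have "s * s ^ n * (pretzel_bracket n c A * (A ^ (n * c) * d ^ Suc n)) =
      s * (s * (d\<^sup>2 - 1 + (- s) ^ c)) ^ n + s * (d\<^sup>2 - 1) * (s * ((- s) ^ c - 1)) ^ n"
    unfolding pretzel_bracket_closed_form[OF assms(1,2) \<open>A \<noteq> 0\<close> d_def] s[symmetric]
    by (rule scale)
  also have "s * (d\<^sup>2 - 1 + (- s) ^ c) = s * (- s) ^ c + (1 + s + s\<^sup>2)"
    using adjoint_dim by (simp add: algebra_simps)
  finally have "s * s ^ n * (pretzel_bracket n c A * (A ^ (n * c) * d ^ Suc n)) = poly (pretzel_poly n c) s"
    unfolding adjoint_dim poly_pretzel_poly .
  from arg_cong[OF this, of cmod]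
  have "cmod s * cmod s ^ n * (cmod (pretzel_bracket n c A) * (cmod A ^ (n * c) * cmod d ^ Suc n)) =
      cmod (poly (pretzel_poly n c) s)"
    by (simp only: norm_mult norm_power)
  moreover have "cmod s = 1"
    using A s by (simp add: norm_power)
  moreover have "cmod d = cmod (s + 1)"
    using arg_cong[OF d_mult, of cmod] A
    by (simp only: norm_mult norm_power norm_minus_cancel power_one mult_1_right)
  ultimately show ?thesis
    using A by simp
qed

lemma ln_cmod_pretzel_jones:
  assumes "n > 0" "c > 0" and A: "cmod A = 1"
    and nonzero: "poly (pretzel_poly n c) (A ^ 4) \<noteq> 0" "A ^ 4 + 1 \<noteq> 0"
  shows "ln (cmod (pretzel_jones_A w n c A)) =
    ln (cmod (poly (pretzel_poly n c) (A ^ 4))) - real (Suc n) * ln (cmod (A ^ 4 + 1))"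
proof -
  note bracket = cmod_pretzel_bracket[OF assms(1,2) A refl]
  have "cmod (pretzel_jones_A w n c A) = cmod (pretzel_bracket n c A)"
    using A by (simp add: pretzel_jones_A_def norm_mult norm_power_int norm_power)
  moreover have "cmod (pretzel_bracket n c A) > 0"
    using bracket nonzero(1) by (metis mult_zero_left norm_eq_zero zero_less_norm_iff)
  moreover have "cmod (A ^ 4 + 1) > 0"
    using nonzero(2) by simp
  ultimately show ?thesis
    unfolding bracket[symmetric] by (simp add: ln_mult_pos ln_realpow del: power_Suc)
qed

lemma pretzel_jones_mahler_eq_mahler_measure:
  assumes "n > 0" "c \<ge> 2"
  shows "pretzel_jones_mahler w n c = mahler_measure (pretzel_poly n c)"
proof -
  let ?P = "pretzel_poly n c" and ?L = "[:1, 1:] :: complex poly"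
  let ?V = "\<lambda>x. ln (cmod (pretzel_jones_A w n c (cis (- (pi * x / 2)))))"
  let ?f = "\<lambda>x. ln (cmod (poly ?P (cis (2 * pi * x)))) -
      real (Suc n) * ln (cmod (poly ?L (cis (2 * pi * x))))"
  have nonzero: "?P \<noteq> 0" "c > 0"
    using pretzel_poly_nonzero[OF assms] assms(2) by auto
  have "mahler_measure ?L = 1"
    by (simp add: mahler_measure_def)
  then have has_int: "(?f has_integral ln (mahler_measure ?P) - real (Suc n) * ln 1) {0..1}"
    using jensen_poly[of ?L] by (intro has_integral_diff has_integral_mult_right jensen_poly nonzero) simp
  have jones: "?V (1 - x) = ?f x"
    if x: "x \<in> {0..1} - {x \<in> {0..1}. poly (?P * ?L) (cis (2 * pi * x)) = 0}" for x
  proof -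
    have "real 4 * (- (pi * (1 - x) / 2)) = 2 * pi * x - 2 * pi"
      by (simp add: field_simps)
    then have fourth_power: "cis (- (pi * (1 - x) / 2)) ^ 4 = cis (2 * pi * x)"
      unfolding Complex.DeMoivre by (simp flip: cis_divide)
    have "poly ?P (cis (2 * pi * x)) * poly ?L (cis (2 * pi * x)) \<noteq> 0"
      using x unfolding poly_mult by blast
    then have "poly ?P (cis (2 * pi * x)) \<noteq> 0" "cis (2 * pi * x) + 1 \<noteq> 0"
      by (auto simp: add.commute)
    with ln_cmod_pretzel_jones[OF assms(1) nonzero(2), of "cis (- (pi * (1 - x) / 2))" w] show ?thesis
      unfolding fourth_power by (simp add: add.commute)
  qed
  have "finite {x \<in> {0..1}. poly (?P * ?L) (cis (2 * pi * x)) = 0}"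
    by (intro finite_circle_roots no_zero_divisors nonzero) simp
  from has_integral_spike_finite[OF this jones has_int]
  have "((\<lambda>x. ?V (1 - x)) has_integral ln (mahler_measure ?P)) {0..1}"
    by simp
  from has_integral_affinity01[OF this, of "- 1" 1]
  have "(?V has_integral ln (mahler_measure ?P)) {0..1}"
    by simp
  then show ?thesis
    unfolding pretzel_jones_mahler_def mahler_measure_circle_def
    using mahler_measure_pos[OF nonzero(1)] by (simp add: integral_unique)
qed

theorem pretzel_jones_mahler_at_top:
  assumes "c \<ge> 2"
  shows "filterlim (\<lambda>n. pretzel_jones_mahler (w n) n c) at_top sequentially"
proof -
  have c_pos: "c > 0"
    using assms by simp
  obtain \<zeta> where \<zeta>: "cmod \<zeta> = 1" "poly (adjoint_eigen_poly c) \<zeta> = 0" "poly (trivial_eigen_poly c) \<zeta> \<noteq> 0"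
    by (rule adjoint_eigen_poly_circle_root[OF assms])
  have "filterlim (\<lambda>n. mahler_measure (pretzel_poly n c)) at_top sequentially"
    unfolding pretzel_poly_def
  proof (rule mahler_measure_power_sum_at_top[OF _ _ adjoint_eigen_poly_root_in_disc[OF c_pos] \<zeta>(2,1,3)])
    show "degree (trivial_eigen_poly c) \<le> degree (adjoint_eigen_poly c)"
      using c_pos by (simp add: degree_adjoint_eigen_poly degree_trivial_eigen_poly)
    show "1 \<le> cmod (lead_coeff (adjoint_eigen_poly c))"
      using cmod_lead_coeff_adjoint_eigen_poly[OF c_pos] by simp
  qed auto
  moreover have "eventually (\<lambda>n. pretzel_jones_mahler (w n) n c = mahler_measure (pretzel_poly n c))
      sequentially"
    using eventually_gt_at_top[of 0]
    by eventually_elim (rule pretzel_jones_mahler_eq_mahler_measure[OF _ assms])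
  ultimately show ?thesis
    by (simp add: filterlim_cong[OF refl refl])
qed

theorem theorem4p1:
  fixes k :: nat and w :: "nat \<Rightarrow> int"
  assumes "k \<ge> 1"
  shows "filterlim (\<lambda>n. pretzel_jones_mahler (w n) n (2*k+1)) at_top sequentially"
  using assms by (intro pretzel_jones_mahler_at_top) simp

end
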